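(* Let $\mathcal{A}=\mathcal{A}_n^{\bar q,\Lambda}(\mathbb{K})$ and suppose $q_1,\dots,q_n$ are multiplicatively independent, i.e. $q_1^{i_1}q_2^{i_2}\cdots q_n^{i_n}=1$ with $i_1,\dots,i_n\in\mathbb{Z}$ implies $i_1=\cdots=i_n=0$. Then every $\mathbb{K}$-algebra endomorphism of the localization $\mathcal{A}_{\mathcal{Z}}$ is a $\mathbb{K}$-algebra automorphism.
   Context: Let $\mathbb{K}$ be a field, $n\ge 1$, $\bar q=(q_1,\dots,q_n)\in(\mathbb{K}^* )^n$, and $\Lambda=(\lambda_{ij})$ an $n\times n$ matrix over $\mathbb{K}^*$ with $\lambda_{ij}=\lambda_{ji}^{-1}$, $\lambda_{ii}=1$. $\mathcal{A}_n^{\bar q,\Lambda}(\mathbb{K})$ is the $\mathbb{K}$-algebra generated by $x_1,y_1,\dots,x_n,y_n$ with relations: for $1\le i<j\le n$, $x_ix_j=\lambda_{ij}x_jx_i$, $y_jy_i=\lambda_{ji}y_iy_j$, $x_iy_j=\lambda_{ji}y_jx_i$, $x_jy_i=\lambda_{ij}y_ix_j$; and $x_iy_i-q_iy_ix_i=1$ for all $i$. Put $z_i=x_iy_i-y_ix_i$; these are pairwise commuting normal elements ($z_iy_i=q_iy_iz_i$, $z_ix_i=q_i^{-1}x_iz_i$, $z_i$ commutes with $x_j,y_j$ for $j\ne i$). $\mathcal{Z}$ is the multiplicative submonoid of $\mathcal{A}$ generated by $z_1,\dots,z_n$ (an Ore set), and $\mathcal{A}_{\mathcal{Z}}$ is the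 localization of $\mathcal{A}$ at $\mathcal{Z}$. *)

theory Defs
  imports Main "HOL-Library.Poly_Mapping"
begin

datatype 'n gen = X 'n | Y 'n | W 'n
  \<comment> \<open>generators x_i, y_i and w_i (w_i will be the inverse of z_i)\<close>

type_synonym ('n, 'k) fa = "'n gen list \<Rightarrow>\<^sub>0 'k"

definition fa_one :: "('n, 'k::field) fa" where
  "fa_one = Poly_Mapping.single [] 1"

definition fa_scal :: "'k::field \<Rightarrow> ('n, 'k) fa \<Rightarrow> ('n, 'k) fa" where
  "fa_scal c p = Poly_Mapping.map (\<lambda>a. c * a) p"

definition fa_mult :: "('n, 'k::field) fa \<Rightarrow> ('n, 'k) fa \<Rightarrow> ('n, 'k) fa" where
  "fa_mult p r = (\<Sum>u\<in>Poly_Mapping.keys p. \<Sum>v\<in>Poly_Mapping.keys r.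
       Poly_Mapping.single (u @ v) (Poly_Mapping.lookup p u * Poly_Mapping.lookup r v))"

definition fa_gen :: "'n gen \<Rightarrow> ('n, 'k::field) fa" where
  "fa_gen g = Poly_Mapping.single [g] 1"

fun fa_word :: "('n gen \<Rightarrow> ('n, 'k::field) fa) \<Rightarrow> 'n gen list \<Rightarrow> ('n, 'k) fa" where
  "fa_word img [] = fa_one"
| "fa_word img (g # u) = fa_mult (img g) (fa_word img u)"

definition fa_subst :: "('n gen \<Rightarrow> ('n, 'k::field) fa) \<Rightarrow> ('n, 'k) fa \<Rightarrow> ('n, 'k) fa" where
  "fa_subst img p = (\<Sum>u\<in>Poly_Mapping.keys p. fa_scal (Poly_Mapping.lookup p u) (fa_word img u))"

inductive_set fa_ideal :: "('n, 'k::field) fa set \<Rightarrow> ('n, 'k) fa set" for R where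
  gen: "r \<in> R \<Longrightarrow> r \<in> fa_ideal R"
| zero: "0 \<in> fa_ideal R"
| add: "a \<in> fa_ideal R \<Longrightarrow> b \<in> fa_ideal R \<Longrightarrow> a + b \<in> fa_ideal R"
| lmult: "a \<in> fa_ideal R \<Longrightarrow> fa_mult c a \<in> fa_ideal R"
| rmult: "a \<in> fa_ideal R \<Longrightarrow> fa_mult a c \<in> fa_ideal R"

definition gx :: "'n \<Rightarrow> ('n, 'k::field) fa" where "gx i = fa_gen (X i)"
definition gy :: "'n \<Rightarrow> ('n, 'k::field) fa" where "gy i = fa_gen (Y i)"
definition gw :: "'n \<Rightarrow> ('n, 'k::field) fa" where "gw i = fa_gen (W i)"
definition gz :: "'n \<Rightarrow> ('n, 'k::field) fa" where
  "gz i = fa_mult (gx i) (gy i) - fa_mult (gy i) (gx i)"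

text \<open>Relations of A (each element r stands for the relation r = 0), indices i < j
  for the commutation relations, as in the paper.\<close>
definition A_rels :: "('n::linorder \<Rightarrow> 'k::field) \<Rightarrow> ('n \<Rightarrow> 'n \<Rightarrow> 'k) \<Rightarrow> ('n, 'k) fa set" where
  "A_rels q L =
     {fa_mult (gx i) (gx j) - fa_scal (L i j) (fa_mult (gx j) (gx i)) | i j. i < j}
   \<union> {fa_mult (gy j) (gy i) - fa_scal (L j i) (fa_mult (gy i) (gy j)) | i j. i < j}
   \<union> {fa_mult (gx i) (gy j) - fa_scal (L j i) (fa_mult (gy j) (gx i)) | i j. i < j}
   \<union> {fa_mult (gx j) (gy i) - fa_scal (L i j) (fa_mult (gy i) (gx j)) | i j. i < j}
   \<union> {fa_mult (gx i) (gy i) - fa_scal (q i) (fa_mult (gy i) (gx i)) - fa_one | i. True}"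

definition AZ_rels :: "('n::linorder \<Rightarrow> 'k::field) \<Rightarrow> ('n \<Rightarrow> 'n \<Rightarrow> 'k) \<Rightarrow> ('n, 'k) fa set" where
  "AZ_rels q L = A_rels q L
   \<union> {fa_mult (gw i) (gz i) - fa_one | i. True}
   \<union> {fa_mult (gz i) (gw i) - fa_one | i. True}"

definition AZ_ideal :: "('n::linorder \<Rightarrow> 'k::field) \<Rightarrow> ('n \<Rightarrow> 'n \<Rightarrow> 'k) \<Rightarrow> ('n, 'k) fa set" where
  "AZ_ideal q L = fa_ideal (AZ_rels q L)"

text \<open>An assignment img of the generators determines a K-algebra endomorphism of
  A_Z = free algebra / AZ_ideal iff substitution maps the ideal into itself;
  the induced endomorphism is an automorphism iff it is bijective on the quotient.\<close>

definition AZ_endo :: "('n::linorder \<Rightarrow> 'k::field) \<Rightarrow> ('n \<Rightarrow> 'n \<Rightarrow> 'k) \<Rightarrow> ('n gen \<Rightarrow> ('n, 'k) fa) \<Rightarrow> bool" where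
  "AZ_endo q L img \<longleftrightarrow> (\<forall>p \<in> AZ_ideal q L. fa_subst img p \<in> AZ_ideal q L)"

definition AZ_auto :: "('n::linorder \<Rightarrow> 'k::field) \<Rightarrow> ('n \<Rightarrow> 'n \<Rightarrow> 'k) \<Rightarrow> ('n gen \<Rightarrow> ('n, 'k) fa) \<Rightarrow> bool" where
  "AZ_auto q L img \<longleftrightarrow> AZ_endo q L img
     \<and> (\<forall>p. fa_subst img p \<in> AZ_ideal q L \<longrightarrow> p \<in> AZ_ideal q L)
     \<and> (\<forall>f. \<exists>g. fa_subst img g - f \<in> AZ_ideal q L)"

end

theory Submission
  imports Defs "HOL.Vector_Spaces" "HOL-Library.Product_Lexorder"
begin

text \<open>
  The algebra embeds into the quantum torus with generators $X_i, Z_i$ via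
  $x_i \mapsto X_i$, $z_i \mapsto Z_i$, $y_i \mapsto (q_i - 1)^{-1} (Z_i - 1) X_i^{-1}$. The torus
  is a twisted group algebra of a linearly ordered group, so the largest and the smallest exponent of
  an element are additive on products; normal forms $z^m v^a$, with $v_i^{a_i}$ a power of $x_i$ or
  of $y_i$ according to the sign of $a_i$, have distinct leading exponents and hence form a basis.

  An endomorphism $\varphi$ maps the unit $z_i$ to a unit, which is a monomial in the torus. An element
  of the image that is homogeneous of $X$-degree $a$ has width (largest minus smallest exponent) at
  least $\sum_i \max(0, -a_i) Z_i$; applied to $\varphi(z_i)^{\pm 1}$ this shows that $\varphi(z_i)$ is
  a monomial in the $Z_j$. Comparing the commutation of $\varphi(z_i)$ with $\varphi(x_j)$ and
  $\varphi(y_j)$, multiplicative independence forces $\varphi(z_i) = c_i z_i^{\epsilon_i}$ with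
  $\epsilon_i = \pm 1$ and makes $\varphi(x_i)$, $\varphi(y_i)$ homogeneous of degrees
  $\pm\epsilon_i$. Injectivity then follows by comparing leading exponents. Finally
  $(q_i - 1) \varphi(y_i) \varphi(x_i) = c_i z_i^{\epsilon_i} - 1$ has width $Z_i$, which is the sum of
  the minimal widths of the two factors, so both factors are normal monomials and $\varphi$ is
  surjective.
\<close>

abbreviation lk :: "('a \<Rightarrow>\<^sub>0 'b::zero) \<Rightarrow> 'a \<Rightarrow> 'b" where
  "lk \<equiv> Poly_Mapping.lookup"

abbreviation ks :: "('a \<Rightarrow>\<^sub>0 'b::zero) \<Rightarrow> 'a set" where
  "ks \<equiv> Poly_Mapping.keys"

abbreviation sgl :: "'a \<Rightarrow> 'b::zero \<Rightarrow> 'a \<Rightarrow>\<^sub>0 'b" where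
  "sgl \<equiv> Poly_Mapping.single"

section \<open>Linear extension\<close>

text \<open>\<open>fa_scal\<close> acts on the free algebra only; the same scaling over an arbitrary
  index type serves the torus as well.\<close>

definition scl :: "'k::field \<Rightarrow> ('a \<Rightarrow>\<^sub>0 'k) \<Rightarrow> 'a \<Rightarrow>\<^sub>0 'k" where
  "scl c p = Poly_Mapping.map ((*) c) p"

lemma lookup_scl [simp]: "lk (scl c p) k = c * lk p k"
  unfolding scl_def by transfer (simp add: when_def)

lemma scl_single [simp]: "scl c (sgl u d) = sgl u (c * d)"
  by (rule poly_mapping_eqI) (simp add: lookup_single when_def)

interpretation pm: vector_space scl
  by unfold_locales (rule poly_mapping_eqI, simp add: lookup_add algebra_simps)+

lemma poly_mapping_sum_single: "p = (\<Sum>u\<in>ks p. sgl u (lk p u))"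
  by (rule poly_mapping_eqI)
     (auto simp: lookup_sum lookup_single when_def in_keys_iff sum.delta' cong: if_cong)

lemma poly_mapping_single_induct [case_names single add]:
  fixes p :: "'a \<Rightarrow>\<^sub>0 'b::comm_monoid_add"
  assumes single: "\<And>u c. P (sgl u c)" and add: "\<And>p r. P p \<Longrightarrow> P r \<Longrightarrow> P (p + r)"
  shows "P p"
proof -
  have "P (\<Sum>u\<in>A. sgl u (lk p u))" if "finite A" for A
    using that
  proof (induction A rule: finite_induct)
    case empty
    then show ?case using single[of undefined 0] by simp
  qed (simp add: single add)
  from this[OF finite_keys, of p] show ?thesis by (simp flip: poly_mapping_sum_single)
qed

definition lext :: "('a \<Rightarrow> 'b \<Rightarrow>\<^sub>0 'k::field) \<Rightarrow> ('a \<Rightarrow>\<^sub>0 'k) \<Rightarrow> 'b \<Rightarrow>\<^sub>0 'k" where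
  "lext f p = (\<Sum>u\<in>ks p. scl (lk p u) (f u))"

text \<open>Elements with different supports can thus be expanded over one common index set.\<close>

lemma lext_superset:
  assumes "finite A" "ks p \<subseteq> A"
  shows "lext f p = (\<Sum>u\<in>A. scl (lk p u) (f u))"
  unfolding lext_def by (rule sum.mono_neutral_left) (use assms in \<open>auto simp: in_keys_iff\<close>)

lemma lext_single [simp]: "lext f (sgl u c) = scl c (f u)"
  by (subst lext_superset[of "{u}"]) auto

lemma lext_zero [simp]: "lext f 0 = 0"
  by (simp add: lext_def)

lemma lext_add: "lext f (p + r) = lext f p + lext f r"
proof -
  have "ks (p + r) \<subseteq> ks p \<union> ks r" by (rule keys_add)
  then show ?thesis
    by (simp add: lext_superset[of "ks p \<union> ks r"] lookup_add pm.scale_left_distrib sum.distrib)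
qed

lemma lext_scl: "lext f (scl c p) = scl c (lext f p)"
proof -
  have "ks (scl c p) \<subseteq> ks p" by (auto simp: in_keys_iff)
  then show ?thesis
    by (simp add: lext_superset[of "ks p"] pm.scale_sum_right)
qed

lemma lext_fun_add: "lext (\<lambda>u. f u + g u) p = lext f p + lext g p"
  by (simp add: lext_def pm.scale_right_distrib sum.distrib)

lemma lext_fun_scl: "lext (\<lambda>u. scl c (f u)) p = scl c (lext f p)"
  by (simp add: lext_def pm.scale_sum_right mult.commute)

section \<open>Twisted monoid algebras\<close>

text \<open>With concatenation as addition, the free algebra is a monoid ring in the sense of
  \<^theory>\<open>HOL-Library.Poly_Mapping\<close>, and its product is the generic one.\<close>

instantiation list :: (type) monoid_add
begin

definition zero_list :: "'a list" where "0 = []"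
definition plus_list :: "'a list \<Rightarrow> 'a list \<Rightarrow> 'a list" where "xs + ys = xs @ ys"

instance by standard (simp_all add: zero_list_def plus_list_def)

end

lemma single_Nil: "sgl [] 1 = 1"
  by (fold zero_list_def) (rule single_one)

text \<open>Basis elements multiply to a \<chi>-multiple of the basis element at the sum of their
  indices, and \<open>cocycle\<close> is associativity on the basis. The trivial twist on words
  gives the free algebra, the twist \<open>chi\<close> below gives the quantum torus.\<close>

locale twisted_algebra =
  fixes \<chi> :: "'g::monoid_add \<Rightarrow> 'g \<Rightarrow> 'k::field"
  assumes cocycle: "\<chi> u v * \<chi> (u + v) w = \<chi> v w * \<chi> u (v + w)"
    and twist_zero_left: "\<chi> 0 u = 1"
    and twist_zero_right: "\<chi> u 0 = 1"
begin

definition tmult :: "('g \<Rightarrow>\<^sub>0 'k) \<Rightarrow> ('g \<Rightarrow>\<^sub>0 'k) \<Rightarrow> 'g \<Rightarrow>\<^sub>0 'k" (infixl \<open>\<odot>\<close> 70) where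
  "p \<odot> r = lext (\<lambda>u. lext (\<lambda>v. sgl (u + v) (\<chi> u v)) r) p"

lemma tmult_single: "sgl u c \<odot> sgl v d = sgl (u + v) (c * d * \<chi> u v)"
  by (simp add: tmult_def algebra_simps)

lemma tmult_add_left: "(p + p') \<odot> r = p \<odot> r + p' \<odot> r"
  by (simp add: tmult_def lext_add)

lemma tmult_add_right: "p \<odot> (r + r') = p \<odot> r + p \<odot> r'"
  by (simp add: tmult_def lext_add lext_fun_add)

lemma tmult_scl_left [simp]: "scl c p \<odot> r = scl c (p \<odot> r)"
  by (simp add: tmult_def lext_scl)

lemma tmult_scl_right [simp]: "p \<odot> scl c r = scl c (p \<odot> r)"
  by (simp add: tmult_def lext_scl lext_fun_scl)

lemma tmult_zero_left [simp]: "0 \<odot> r = 0"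
  by (simp add: tmult_def)

lemma tmult_zero_right [simp]: "p \<odot> 0 = 0"
  using tmult_scl_right[of p 0 0] by simp

lemma tmult_diff_left: "(p - p') \<odot> r = p \<odot> r - p' \<odot> r"
  using tmult_add_left[of "p - p'" p' r] by (simp add: algebra_simps)

lemma tmult_diff_right: "p \<odot> (r - r') = p \<odot> r - p \<odot> r'"
  using tmult_add_right[of p "r - r'" r'] by (simp add: algebra_simps)

lemma tmult_assoc: "(p \<odot> r) \<odot> s = p \<odot> (r \<odot> s)"
proof (induction p rule: poly_mapping_single_induct)
  case (single u a)
  show ?case
  proof (induction r rule: poly_mapping_single_induct)
    case (single v b)
    show ?case
    proof (induction s rule: poly_mapping_single_induct)
      case (single w c)
      have "a * b * \<chi> u v * c * \<chi> (u + v) w = a * (b * c * \<chi> v w) * \<chi> u (v + w)"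
        using cocycle[of u v w] by (simp add: algebra_simps)
      then show ?case by (simp only: tmult_single add.assoc)
    qed (simp add: tmult_add_right)
  qed (simp add: tmult_add_right tmult_add_left)
qed (simp add: tmult_add_left)

lemma tmult_one_left [simp]: "1 \<odot> p = p"
  by (induction p rule: poly_mapping_single_induct)
     (simp_all add: tmult_single tmult_add_right twist_zero_left flip: single_one)

lemma tmult_one_right [simp]: "p \<odot> 1 = p"
  by (induction p rule: poly_mapping_single_induct)
     (simp_all add: tmult_single tmult_add_left twist_zero_right flip: single_one)

lemma tmult_keys_sum:
  "p \<odot> r = (\<Sum>u\<in>ks p. \<Sum>v\<in>ks r. sgl (u + v) (lk p u * lk r v * \<chi> u v))"
  by (simp add: tmult_def lext_def pm.scale_sum_right mult.assoc)

lemma lookup_tmult: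
  "lk (p \<odot> r) k = (\<Sum>u\<in>ks p. \<Sum>v\<in>ks r. if u + v = k then lk p u * lk r v * \<chi> u v else 0)"
  by (simp add: tmult_keys_sum lookup_sum lookup_single when_def)

lemma keys_tmult:
  assumes "k \<in> ks (p \<odot> r)"
  obtains u v where "u \<in> ks p" "v \<in> ks r" "k = u + v"
proof -
  have "\<exists>u\<in>ks p. \<exists>v\<in>ks r. u + v = k"
  proof (rule ccontr)
    assume "\<not> ?thesis"
    then have "lk (p \<odot> r) k = 0"
      unfolding lookup_tmult by (intro sum.neutral ballI) auto
    with assms show False by (simp add: in_keys_iff)
  qed
  then show thesis using that by blast
qed

text \<open>The source is always the free algebra: a homomorphism out of the localization is handled
  as one out of the free algebra that vanishes on the ideal.\<close>

definition algebra_hom :: "(('n, 'k) fa \<Rightarrow> 'g \<Rightarrow>\<^sub>0 'k) \<Rightarrow> bool" where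
  "algebra_hom h \<longleftrightarrow> (\<forall>p r. h (p + r) = h p + h r) \<and> (\<forall>c p. h (scl c p) = scl c (h p))
     \<and> (\<forall>p r. h (p * r) = h p \<odot> h r) \<and> h 1 = 1"

fun tword :: "('n gen \<Rightarrow> 'g \<Rightarrow>\<^sub>0 'k) \<Rightarrow> 'n gen list \<Rightarrow> 'g \<Rightarrow>\<^sub>0 'k" where
  "tword f [] = 1"
| "tword f (g # u) = f g \<odot> tword f u"

lemma tword_append: "tword f (u @ v) = tword f u \<odot> tword f v"
  by (induction u) (simp_all add: tmult_assoc)

text \<open>Universal property of the free algebra. By bilinearity, multiplicativity need only be
  checked on two words, where it is \<open>tword_append\<close>.\<close>

lemma algebra_hom_lext: "algebra_hom (lext (tword f))"
proof -
  have "lext (tword f) (p * r) = lext (tword f) p \<odot> lext (tword f) r" for p r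
  proof (induction p rule: poly_mapping_single_induct)
    case (single u a)
    show ?case
    proof (induction r rule: poly_mapping_single_induct)
      case (single v b)
      show ?case by (simp add: mult_single tword_append plus_list_def mult.commute)
    qed (simp add: tmult_add_right lext_add distrib_left)
  qed (simp add: tmult_add_left lext_add distrib_right)
  moreover have "lext (tword f) 1 = 1"
    using lext_single[of "tword f" "[]" 1] by (simp add: single_Nil)
  ultimately show ?thesis by (simp add: algebra_hom_def lext_add lext_scl)
qed

lemma lext_tword_generator [simp]: "lext (tword f) (fa_gen g) = f g"
  by (simp add: fa_gen_def)

context
  fixes h :: "('n, 'k) fa \<Rightarrow> 'g \<Rightarrow>\<^sub>0 'k"
  assumes h: "algebra_hom h"
begin

lemma hom_add: "h (p + r) = h p + h r"
  and hom_scl: "h (scl c p) = scl c (h p)"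
  and hom_mult: "h (p * r) = h p \<odot> h r"
  and hom_one: "h 1 = 1"
  using h by (simp_all add: algebra_hom_def)

lemma hom_zero: "h 0 = 0"
  using hom_scl[of 0 0] by simp

lemma hom_diff: "h (p - r) = h p - h r"
  using hom_add[of "p - r" r] by (simp add: algebra_simps)

lemma hom_sum: "h (\<Sum>i\<in>A. f i) = (\<Sum>i\<in>A. h (f i))"
  by (induction A rule: infinite_finite_induct) (simp_all add: hom_add hom_zero)

end

end

section \<open>The free algebra\<close>

lemma fa_scal_eq_scl: "fa_scal = scl"
  by (simp add: fun_eq_iff fa_scal_def scl_def)

lemma fa_one_eq: "fa_one = 1"
  by (simp add: fa_one_def single_Nil)

lemma scl_eq_mult: "scl c p = sgl 0 c * p" for p :: "('n, 'k::field) fa"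
  by (simp add: scl_def mult_map_scale_conv_mult)

interpretation fa: twisted_algebra "\<lambda>(_::'n gen list) (_::'n gen list). 1::'k::field"
  by unfold_locales simp_all

text \<open>Both products are bilinear and agree on words. This makes the ring structure of
  \<open>poly_mapping\<close> available for the free algebra.\<close>

lemma fa_tmult_eq_times: "fa.tmult p r = p * r" for p r :: "('n, 'k::field) fa"
proof (induction p rule: poly_mapping_single_induct)
  case (single u a)
  show ?case
    by (induction r rule: poly_mapping_single_induct)
       (simp_all add: fa.tmult_single mult_single fa.tmult_add_right distrib_left)
qed (simp add: fa.tmult_add_left distrib_right)

lemma fa_mult_eq_times: "fa_mult p r = p * r"
  by (simp add: fa_tmult_eq_times[symmetric] fa.tmult_keys_sum fa_mult_def plus_list_def)

lemma scl_mult_left [simp]: "scl c p * r = scl c (p * r)" for p r :: "('n, 'k::field) fa"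
  by (simp flip: fa_tmult_eq_times)

lemma scl_mult_right [simp]: "p * scl c r = scl c (p * r)" for p r :: "('n, 'k::field) fa"
  by (simp flip: fa_tmult_eq_times)

lemma fa_subst_eq_lext: "fa_subst f = lext (fa.tword f)"
proof -
  have "fa_word f u = fa.tword f u" for u
    by (induction u) (simp_all add: fa_one_eq fa_mult_eq_times fa_tmult_eq_times)
  then show ?thesis by (simp add: fun_eq_iff fa_subst_def lext_def fa_scal_eq_scl)
qed

lemma algebra_hom_fa_subst: "fa.algebra_hom (fa_subst f)"
  by (simp add: fa_subst_eq_lext fa.algebra_hom_lext)

lemma gz_eq: "gz i = gx i * gy i - gy i * gx i"
  by (simp add: gz_def fa_mult_eq_times)

lemma (in twisted_algebra) algebra_hom_comp_subst:
  assumes "algebra_hom h"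
  shows "algebra_hom (\<lambda>p. h (fa_subst f p))"
  using assms algebra_hom_fa_subst[of f] unfolding algebra_hom_def fa.algebra_hom_def
  by (simp add: fa_tmult_eq_times)

lemma fa_ideal_uminus: "p \<in> fa_ideal R \<Longrightarrow> - p \<in> fa_ideal R"
  using fa_ideal.lmult[of p R "-1"] by (simp add: fa_mult_eq_times)

lemma fa_ideal_diff: "p \<in> fa_ideal R \<Longrightarrow> r \<in> fa_ideal R \<Longrightarrow> p - r \<in> fa_ideal R"
  using fa_ideal.add[OF _ fa_ideal_uminus, of p R r] by simp

lemma fa_ideal_scl: "p \<in> fa_ideal R \<Longrightarrow> scl c p \<in> fa_ideal R"
  using fa_ideal.lmult[of p R "sgl 0 c"] by (simp add: fa_mult_eq_times scl_eq_mult)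

lemma fa_ideal_mult_left: "p \<in> fa_ideal R \<Longrightarrow> r * p \<in> fa_ideal R"
  using fa_ideal.lmult[of p R r] by (simp add: fa_mult_eq_times)

lemma fa_ideal_mult_right: "p \<in> fa_ideal R \<Longrightarrow> p * r \<in> fa_ideal R"
  using fa_ideal.rmult[of p R r] by (simp add: fa_mult_eq_times)

text \<open>A word is built from the left, one letter at a time. Both the spanning by normal forms
  and surjectivity thereby reduce to left multiplication by a generator.\<close>

lemma fa_generator_induct [case_names one generator add scl]:
  fixes p :: "('n, 'k::field) fa"
  assumes one: "P 1" and generator: "\<And>g p. P p \<Longrightarrow> P (fa_gen g * p)"
    and add: "\<And>p r. P p \<Longrightarrow> P r \<Longrightarrow> P (p + r)" and scl: "\<And>c p. P p \<Longrightarrow> P (scl c p)"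
  shows "P p"
proof (induction p rule: poly_mapping_single_induct)
  case (single u c)
  have "P (sgl u 1)"
  proof (induction u)
    case Nil
    then show ?case using one by (simp add: single_Nil)
  next
    case (Cons g u)
    from generator[OF this, of g] show ?case by (simp add: fa_gen_def mult_single plus_list_def)
  qed
  from scl[OF this, of c] show ?case by simp
qed (rule add)

lemma (in twisted_algebra) hom_vanishes_on_ideal:
  assumes h: "algebra_hom h" and R: "\<And>r. r \<in> R \<Longrightarrow> h r = 0" and "p \<in> fa_ideal R"
  shows "h p = 0"
  using assms(3)
  by (induction rule: fa_ideal.induct)
     (simp_all add: R fa_mult_eq_times hom_add[OF h] hom_mult[OF h] hom_zero[OF h])

section \<open>Twisted algebras of ordered groups\<close>

text \<open>Used to split an equality of extremal exponents, or of widths, of a product into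
  equalities for the two factors.\<close>

lemma add_mono_eq_imp:
  fixes a b c d :: "'g::linordered_ab_group_add"
  assumes "a \<le> b" "c \<le> d" "a + c = b + d"
  shows "a = b" "c = d"
  using assms add_less_le_mono[of a b c d] add_le_less_mono[of a b c d] by (auto simp: order.order_iff_strict)

locale ordered_twisted_algebra = twisted_algebra \<chi>
  for \<chi> :: "'g::linordered_ab_group_add \<Rightarrow> 'g \<Rightarrow> 'k::field" +
  assumes twist_nonzero: "\<chi> u v \<noteq> 0"
begin

text \<open>Analogues of the degree and the order of a Laurent polynomial. The values at 0 are
  unspecified, whence the conditions \<open>p \<noteq> 0\<close> below.\<close>

definition mx :: "('g \<Rightarrow>\<^sub>0 'k) \<Rightarrow> 'g" where "mx p = Max (ks p)"
definition mn :: "('g \<Rightarrow>\<^sub>0 'k) \<Rightarrow> 'g" where "mn p = Min (ks p)"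

lemma mx_in_keys: "p \<noteq> 0 \<Longrightarrow> mx p \<in> ks p"
  and mn_in_keys: "p \<noteq> 0 \<Longrightarrow> mn p \<in> ks p"
  by (simp_all add: mx_def mn_def Max_in Min_in)

lemma le_mx: "u \<in> ks p \<Longrightarrow> u \<le> mx p"
  and mn_le: "u \<in> ks p \<Longrightarrow> mn p \<le> u"
  by (simp_all add: mx_def mn_def)

lemma mn_le_mx: "p \<noteq> 0 \<Longrightarrow> mn p \<le> mx p"
  using le_mx mn_in_keys by blast

lemma mx_eqI: "u \<in> ks p \<Longrightarrow> (\<And>v. v \<in> ks p \<Longrightarrow> v \<le> u) \<Longrightarrow> mx p = u"
  and mn_eqI: "u \<in> ks p \<Longrightarrow> (\<And>v. v \<in> ks p \<Longrightarrow> u \<le> v) \<Longrightarrow> mn p = u"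
  by (auto simp: mx_def mn_def intro!: Max_eqI Min_eqI)

lemma mx_single: "c \<noteq> 0 \<Longrightarrow> mx (sgl u c) = u"
  and mn_single: "c \<noteq> 0 \<Longrightarrow> mn (sgl u c) = u"
  by (simp_all add: mx_def mn_def)

lemma mx_one: "mx 1 = 0"
  and mn_one: "mn 1 = 0"
  by (simp_all add: mx_def mn_def)

text \<open>When u + v arises from only one pair of exponents, a single term contributes and nothing
  can cancel. This applies to extremal exponents and to products with a monomial.\<close>

lemma lookup_tmult_unique:
  assumes "u \<in> ks p" "v \<in> ks r"
    and "\<And>u' v'. u' \<in> ks p \<Longrightarrow> v' \<in> ks r \<Longrightarrow> u' + v' = u + v \<Longrightarrow> u' = u"
  shows "lk (p \<odot> r) (u + v) = lk p u * lk r v * \<chi> u v"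
proof -
  have "lk (p \<odot> r) (u + v)
      = (\<Sum>u'\<in>ks p. if u' = u then \<Sum>v'\<in>ks r. if v' = v then lk p u * lk r v * \<chi> u v else 0 else 0)"
    unfolding lookup_tmult
  proof (rule sum.cong)
    fix u' assume u': "u' \<in> ks p"
    show "(\<Sum>v'\<in>ks r. if u' + v' = u + v then lk p u' * lk r v' * \<chi> u' v' else 0)
      = (if u' = u then \<Sum>v'\<in>ks r. if v' = v then lk p u * lk r v * \<chi> u v else 0 else 0)"
    proof (cases "u' = u")
      case True
      then show ?thesis by (auto intro!: sum.cong)
    next
      case False
      then have "u' + v' \<noteq> u + v" if "v' \<in> ks r" for v' using assms(3)[OF u' that] by blast
      with False show ?thesis by (auto intro!: sum.neutral)
    qed
  qed simp
  then show ?thesis using assms(1,2) by simp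
qed

text \<open>The sum of the maxima is reached only by the pair of maxima, and its coefficient is a
  product of nonzero factors; likewise for minima. In particular there are no zero divisors.\<close>

lemma
  assumes "p \<noteq> 0" "r \<noteq> 0"
  shows tmult_nonzero: "p \<odot> r \<noteq> 0"
    and mx_tmult: "mx (p \<odot> r) = mx p + mx r"
    and mn_tmult: "mn (p \<odot> r) = mn p + mn r"
proof -
  have "lk (p \<odot> r) (mx p + mx r) = lk p (mx p) * lk r (mx r) * \<chi> (mx p) (mx r)"
  proof (rule lookup_tmult_unique)
    fix u v assume "u \<in> ks p" "v \<in> ks r" "u + v = mx p + mx r"
    then show "u = mx p"
      using le_mx[of u p] le_mx[of v r] add_mono_eq_imp(1) by blast
  qed (use assms mx_in_keys in auto)
  then have mx: "mx p + mx r \<in> ks (p \<odot> r)"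
    using assms mx_in_keys twist_nonzero by (simp add: in_keys_iff)
  then show "p \<odot> r \<noteq> 0" by auto
  show "mx (p \<odot> r) = mx p + mx r"
    using mx by (rule mx_eqI) (auto elim!: keys_tmult intro!: add_mono le_mx)
  have "lk (p \<odot> r) (mn p + mn r) = lk p (mn p) * lk r (mn r) * \<chi> (mn p) (mn r)"
  proof (rule lookup_tmult_unique)
    fix u v assume "u \<in> ks p" "v \<in> ks r" "u + v = mn p + mn r"
    then show "u = mn p"
      using mn_le[of u p] mn_le[of v r] add_mono_eq_imp(1)[of "mn p" u "mn r" v] by simp
  qed (use assms mn_in_keys in auto)
  then have mn: "mn p + mn r \<in> ks (p \<odot> r)"
    using assms mn_in_keys twist_nonzero by (simp add: in_keys_iff)
  show "mn (p \<odot> r) = mn p + mn r"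
    using mn by (rule mn_eqI) (auto elim!: keys_tmult intro!: add_mono mn_le)
qed

lemma mx_eq_mn_imp_monomial:
  assumes "p \<noteq> 0" "mx p = mn p"
  shows "p = sgl (mx p) (lk p (mx p))" "lk p (mx p) \<noteq> 0"
proof -
  have "u = mx p" if "u \<in> ks p" for u
    using le_mx[OF that] mn_le[OF that] assms(2) by simp
  then have keys: "ks p = {mx p}" using mx_in_keys[OF assms(1)] by blast
  have "p = (\<Sum>u\<in>ks p. sgl u (lk p u))" by (rule poly_mapping_sum_single)
  also have "\<dots> = sgl (mx p) (lk p (mx p))" by (subst keys) simp
  finally show "p = sgl (mx p) (lk p (mx p))" .
  show "lk p (mx p) \<noteq> 0" using mx_in_keys[OF assms(1)] by (simp add: in_keys_iff)
qed

text \<open>The differences \<open>mx - mn\<close> of the two factors are nonnegative and add up to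
  0, so each factor has a single exponent.\<close>

lemma unit_imp_monomial:
  assumes "p \<odot> r = 1"
  obtains u c d where "c \<noteq> 0" "d \<noteq> 0" "p = sgl u c" "r = sgl (- u) d"
proof -
  have nz: "p \<noteq> 0" "r \<noteq> 0" using assms by auto
  have mx: "mx p + mx r = 0" using mx_tmult[OF nz] assms by (simp add: mx_one)
  have mn: "mn p + mn r = 0" using mn_tmult[OF nz] assms by (simp add: mn_one)
  have "mx p = mn p" "mx r = mn r"
    using mx mn add_mono_eq_imp[OF mn_le_mx[OF nz(1)] mn_le_mx[OF nz(2)]] by simp_all
  moreover have "mx r = - mx p" using mx by (simp add: eq_neg_iff_add_eq_0 add.commute)
  ultimately show thesis
    using that mx_eq_mn_imp_monomial[OF nz(1)] mx_eq_mn_imp_monomial[OF nz(2)] by metis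
qed

lemma tmult_twisted_commute:
  assumes "\<And>u v. u \<in> ks p \<Longrightarrow> v \<in> ks r \<Longrightarrow> \<chi> u v = c * \<chi> v u"
  shows "p \<odot> r = scl c (r \<odot> p)"
proof -
  have "p \<odot> r = (\<Sum>u\<in>ks p. \<Sum>v\<in>ks r. scl c (sgl (v + u) (lk r v * lk p u * \<chi> v u)))"
    unfolding tmult_keys_sum
    by (intro sum.cong refl) (simp add: assms add.commute mult.commute mult.left_commute)
  also have "\<dots> = scl c (r \<odot> p)"
    unfolding tmult_keys_sum by (subst sum.swap) (simp add: pm.scale_sum_right del: scl_single)
  finally show ?thesis .
qed

text \<open>Converse of \<open>tmult_twisted_commute\<close> for a monomial factor: distinct v give
  distinct exponents u + v, so coefficients can be compared one at a time.\<close>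

lemma monomial_twisted_commute_key:
  assumes "sgl u c \<odot> t = scl \<kappa> (t \<odot> sgl u c)" "c \<noteq> 0" "v \<in> ks t"
  shows "\<chi> u v = \<kappa> * \<chi> v u"
proof -
  have "lk (sgl u c \<odot> t) (u + v) = c * lk t v * \<chi> u v"
    using assms by (subst lookup_tmult_unique) auto
  moreover have "lk (t \<odot> sgl u c) (u + v) = lk t v * c * \<chi> v u"
    using assms by (subst add.commute, subst lookup_tmult_unique) auto
  ultimately have "c * lk t v * \<chi> u v = \<kappa> * (lk t v * c * \<chi> v u)"
    using assms(1) by (metis lookup_scl)
  then have "(c * lk t v) * \<chi> u v = (c * lk t v) * (\<kappa> * \<chi> v u)"
    by (simp add: algebra_simps)
  then show ?thesis using assms(2,3) by (simp add: in_keys_iff)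
qed

text \<open>The extreme one among the distinct leading exponents occurs in a single summand and
  therefore survives. This is linear independence by leading exponents, with the extremal exponent
  of the sum identified.\<close>

lemma
  assumes M: "finite M" "M \<noteq> {}" and f: "\<And>k. k \<in> M \<Longrightarrow> f k \<noteq> 0"
    and t: "\<And>k. k \<in> M \<Longrightarrow> t k \<noteq> 0"
  defines "s \<equiv> (\<Sum>k\<in>M. scl (f k) (t k))"
  shows sum_distinct_mx: "inj_on (\<lambda>k. mx (t k)) M \<Longrightarrow> s \<noteq> 0 \<and>
      (\<exists>k\<in>M. mx s = mx (t k) \<and> (\<forall>l\<in>M. mx (t l) \<le> mx (t k)))"
    and sum_distinct_mn: "inj_on (\<lambda>k. mn (t k)) M \<Longrightarrow> s \<noteq> 0 \<and>
      (\<exists>k\<in>M. mn s = mn (t k) \<and> (\<forall>l\<in>M. mn (t k) \<le> mn (t l)))"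
proof -
  have keys_s: "\<exists>l\<in>M. u \<in> ks (t l)" if "u \<in> ks s" for u
  proof (rule ccontr)
    assume "\<not> ?thesis"
    then have "lk s u = 0" unfolding s_def lookup_sum by (intro sum.neutral) (auto simp: in_keys_iff)
    with that show False by (simp add: in_keys_iff)
  qed
  have key: "u \<in> ks s" if k: "k \<in> M" "u \<in> ks (t k)" and u: "\<And>l. l \<in> M \<Longrightarrow> l \<noteq> k \<Longrightarrow> u \<notin> ks (t l)" for u k
  proof -
    have "lk s u = (\<Sum>l\<in>M. if l = k then f k * lk (t k) u else 0)"
      unfolding s_def lookup_sum using u by (intro sum.cong) (auto simp: in_keys_iff)
    also have "\<dots> = f k * lk (t k) u" using M k by simp
    finally show ?thesis using f k by (simp add: in_keys_iff)
  qed
  {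
    assume inj: "inj_on (\<lambda>k. mx (t k)) M"
    have "Max ((\<lambda>k. mx (t k)) ` M) \<in> (\<lambda>k. mx (t k)) ` M" using M by (intro Max_in) auto
    then obtain k where k: "k \<in> M" "mx (t k) = Max ((\<lambda>k. mx (t k)) ` M)" by force
    then have le: "mx (t l) \<le> mx (t k)" if "l \<in> M" for l using that M by simp
    have "mx (t k) \<in> ks s"
    proof (rule key[OF k(1) mx_in_keys])
      fix l assume l: "l \<in> M" "l \<noteq> k"
      then have "mx (t l) \<noteq> mx (t k)" using inj k(1) by (auto dest: inj_onD)
      then show "mx (t k) \<notin> ks (t l)" using le[OF l(1)] le_mx[of "mx (t k)" "t l"] by auto
    qed (use t k in auto)
    moreover have "u \<le> mx (t k)" if "u \<in> ks s" for u
      using keys_s[OF that] le le_mx order_trans by blast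
    ultimately show "s \<noteq> 0 \<and> (\<exists>k\<in>M. mx s = mx (t k) \<and> (\<forall>l\<in>M. mx (t l) \<le> mx (t k)))"
      using k(1) le mx_eqI[of "mx (t k)" s] by auto
  next
    assume inj: "inj_on (\<lambda>k. mn (t k)) M"
    have "Min ((\<lambda>k. mn (t k)) ` M) \<in> (\<lambda>k. mn (t k)) ` M" using M by (intro Min_in) auto
    then obtain k where k: "k \<in> M" "mn (t k) = Min ((\<lambda>k. mn (t k)) ` M)" by force
    then have le: "mn (t k) \<le> mn (t l)" if "l \<in> M" for l using that M by simp
    have "mn (t k) \<in> ks s"
    proof (rule key[OF k(1) mn_in_keys])
      fix l assume l: "l \<in> M" "l \<noteq> k"
      then have "mn (t l) \<noteq> mn (t k)" using inj k(1) by (auto dest: inj_onD)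
      then show "mn (t k) \<notin> ks (t l)" using le[OF l(1)] mn_le[of "mn (t k)" "t l"] by auto
    qed (use t k in auto)
    moreover have "mn (t k) \<le> u" if "u \<in> ks s" for u
      using keys_s[OF that] le mn_le order_trans by blast
    ultimately show "s \<noteq> 0 \<and> (\<exists>k\<in>M. mn s = mn (t k) \<and> (\<forall>l\<in>M. mn (t k) \<le> mn (t l)))"
      using k(1) le mn_eqI[of "mn (t k)" s] by auto
  }
qed

end

section \<open>Normal forms\<close>

locale quantum_weyl =
  fixes q :: "'n::{finite,linorder} \<Rightarrow> 'k::field" and L :: "'n \<Rightarrow> 'n \<Rightarrow> 'k"
  assumes q_nz: "\<And>i. q i \<noteq> 0"
    and L_nz: "\<And>i j. L i j \<noteq> 0"
    and L_inv: "\<And>i j. L i j = inverse (L j i)"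
    and mult_indep: "\<And>e :: 'n \<Rightarrow> int. (\<Prod>i\<in>UNIV. q i powi e i) = 1 \<Longrightarrow> (\<forall>i. e i = 0)"
begin

text \<open>Independence applied to a unit vector of exponents; it legitimates the divisions by
  \<open>q i - 1\<close>.\<close>

lemma q_neq_1: "q i \<noteq> 1"
proof
  assume "q i = 1"
  then have "(\<Prod>j\<in>UNIV. q j powi (if j = i then 1 else 0)) = 1"
    by (intro prod.neutral) auto
  from mult_indep[OF this] show False by (metis zero_neq_one)
qed

lemma L_mult [simp]: "L i j * L j i = 1"
  using L_inv[of i j] L_nz[of j i] by simp

section \<open>Congruence modulo the defining ideal\<close>

abbreviation J :: "('n, 'k) fa set" where "J \<equiv> AZ_ideal q L"

lemma J_zero: "0 \<in> J"
  and J_add: "p \<in> J \<Longrightarrow> r \<in> J \<Longrightarrow> p + r \<in> J"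
  and J_diff: "p \<in> J \<Longrightarrow> r \<in> J \<Longrightarrow> p - r \<in> J"
  and J_scl: "p \<in> J \<Longrightarrow> scl c p \<in> J"
  and J_mult_left: "p \<in> J \<Longrightarrow> s * p \<in> J"
  and J_mult_right: "p \<in> J \<Longrightarrow> p * s \<in> J"
  unfolding AZ_ideal_def
  by (simp_all add: fa_ideal.zero fa_ideal.add fa_ideal_diff fa_ideal_scl fa_ideal_mult_left
      fa_ideal_mult_right)

definition cong :: "('n, 'k) fa \<Rightarrow> ('n, 'k) fa \<Rightarrow> bool" (infix \<open>\<approx>\<close> 50) where
  "p \<approx> r \<longleftrightarrow> p - r \<in> J"

lemma cong_refl [simp]: "p \<approx> p"
  by (simp add: cong_def J_zero)

lemma cong_sym: "p \<approx> r \<Longrightarrow> r \<approx> p"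
  using J_diff[OF J_zero, of "p - r"] by (simp add: cong_def)

lemma cong_trans [trans]: "p \<approx> r \<Longrightarrow> r \<approx> s \<Longrightarrow> p \<approx> s"
  using J_add[of "p - r" "r - s"] by (simp add: cong_def)

lemma cong_diff: "p \<approx> p' \<Longrightarrow> r \<approx> r' \<Longrightarrow> p - r \<approx> p' - r'"
  using J_diff[of "p - p'" "r - r'"] by (simp add: cong_def algebra_simps)

lemma cong_scl: "p \<approx> p' \<Longrightarrow> scl c p \<approx> scl c p'"
  using J_scl[of "p - p'" c] by (simp add: cong_def pm.scale_right_diff_distrib)

lemma cong_mult_left: "r \<approx> r' \<Longrightarrow> p * r \<approx> p * r'"
  using J_mult_left[of "r - r'" p] by (simp add: cong_def algebra_simps)

lemma cong_mult_right: "p \<approx> p' \<Longrightarrow> p * r \<approx> p' * r"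
  using J_mult_right[of "p - p'" r] by (simp add: cong_def algebra_simps)

section \<open>Commutation up to a scalar\<close>

definition qcomm :: "'k \<Rightarrow> ('n, 'k) fa \<Rightarrow> ('n, 'k) fa \<Rightarrow> bool" where
  "qcomm c p r \<longleftrightarrow> p * r \<approx> scl c (r * p)"

lemma qcomm_sym:
  assumes "qcomm c p r" "c * d = 1"
  shows "qcomm d r p"
proof -
  have "scl d (p * r) \<approx> scl d (scl c (r * p))"
    using assms by (intro cong_scl) (simp add: qcomm_def)
  then show ?thesis using assms(2) by (simp add: qcomm_def cong_sym mult.commute)
qed

lemma qcomm_mult:
  assumes "qcomm c p r" "qcomm d p s"
  shows "qcomm (c * d) p (r * s)"
proof -
  have "p * (r * s) = (p * r) * s" by (simp add: mult.assoc)
  also have "\<dots> \<approx> scl c (r * p) * s" using assms by (intro cong_mult_right) (simp add: qcomm_def)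
  also have "\<dots> = scl c (r * (p * s))" by (simp add: mult.assoc)
  also have "\<dots> \<approx> scl c (r * scl d (s * p))"
    using assms by (intro cong_scl cong_mult_left) (simp add: qcomm_def)
  finally show ?thesis by (simp add: qcomm_def mult.assoc)
qed

lemma qcomm_one: "qcomm 1 p 1"
  by (simp add: qcomm_def)

lemma qcomm_power: "qcomm c p r \<Longrightarrow> qcomm (c ^ k) p (r ^ k)"
  by (induction k) (simp_all add: qcomm_one qcomm_mult)

lemma qcomm_diff: "qcomm c p r \<Longrightarrow> qcomm c p s \<Longrightarrow> qcomm c p (r - s)"
  using cong_diff[of "p * r" "scl c (r * p)" "p * s" "scl c (s * p)"]
  by (simp add: qcomm_def algebra_simps pm.scale_right_diff_distrib)

lemma rel_xy: "gx i * gy i \<approx> scl (q i) (gy i * gx i) + 1"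
  unfolding cong_def AZ_ideal_def diff_diff_eq[symmetric]
  by (rule fa_ideal.gen) (auto simp: AZ_rels_def A_rels_def fa_mult_eq_times fa_one_eq fa_scal_eq_scl)

lemma rel_wz: "gw i * gz i \<approx> 1" and rel_zw: "gz i * gw i \<approx> 1"
  unfolding cong_def AZ_ideal_def
  by (rule fa_ideal.gen; auto simp: AZ_rels_def fa_mult_eq_times fa_one_eq)+

lemma A_rels_cong: "p - scl c r \<in> A_rels q L \<Longrightarrow> p \<approx> scl c r"
  unfolding cong_def AZ_ideal_def by (rule fa_ideal.gen) (simp add: AZ_rels_def)

lemma
  assumes "i \<noteq> j"
  shows qcomm_xx: "qcomm (L i j) (gx i) (gx j)"
    and qcomm_yy: "qcomm (L i j) (gy i) (gy j)"
    and qcomm_xy: "qcomm (L j i) (gx i) (gy j)"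
proof -
  note [simp] = A_rels_def fa_mult_eq_times fa_scal_eq_scl
  have xx: "qcomm (L i j) (gx i) (gx j)" if "i < j" for i j
    unfolding qcomm_def by (rule A_rels_cong) (use that in auto)
  have yy: "qcomm (L j i) (gy j) (gy i)" if "i < j" for i j
    unfolding qcomm_def by (rule A_rels_cong) (use that in auto)
  consider "i < j" | "j < i" using assms by (meson neqE)
  then show "qcomm (L i j) (gx i) (gx j)" using xx qcomm_sym[OF xx[of j i]] by cases auto
  consider "i < j" | "j < i" using assms by (meson neqE)
  then show "qcomm (L i j) (gy i) (gy j)" using yy qcomm_sym[OF yy[of i j]] by cases auto
  consider "i < j" | "j < i" using assms by (meson neqE)
  then show "qcomm (L j i) (gx i) (gy j)"
    by cases (unfold qcomm_def, (rule A_rels_cong, auto)+)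
qed

text \<open>Conjugation by the inverse of z inverts the scalar: p w = w z p w = d w p z w = d w
  p.\<close>

lemma qcomm_w:
  assumes "qcomm c p (gz i)" "c * d = 1"
  shows "qcomm d p (gw i)"
proof -
  note zp = qcomm_sym[OF assms, unfolded qcomm_def]
  have "p * gw i \<approx> 1 * (p * gw i)" by simp
  also have "\<dots> \<approx> (gw i * gz i) * (p * gw i)" by (rule cong_mult_right[OF cong_sym[OF rel_wz]])
  also have "\<dots> = gw i * ((gz i * p) * gw i)" by (simp add: mult.assoc)
  also have "\<dots> \<approx> gw i * (scl d (p * gz i) * gw i)"
    by (intro cong_mult_left cong_mult_right zp)
  also have "\<dots> = scl d (gw i * p * (gz i * gw i))" by (simp add: mult.assoc)
  also have "\<dots> \<approx> scl d (gw i * p * 1)" by (intro cong_scl cong_mult_left rel_zw)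
  finally show ?thesis by (simp add: qcomm_def)
qed

text \<open>The scalars cancel on both xy and yx, hence on their difference z.\<close>

lemma qcomm_z:
  assumes "qcomm c p (gx i)" "qcomm d p (gy i)" "c * d = 1"
  shows "qcomm 1 p (gz i)"
  using qcomm_diff[of 1 p "gx i * gy i" "gy i * gx i"] qcomm_mult[OF assms(1,2)]
    qcomm_mult[OF assms(2,1)] assms(3) by (simp add: gz_eq mult.commute)

lemma
  assumes "i \<noteq> j"
  shows qcomm_yx: "qcomm (L j i) (gy i) (gx j)"
    and qcomm_xz: "qcomm 1 (gx i) (gz j)"
    and qcomm_yz: "qcomm 1 (gy i) (gz j)"
    and qcomm_xw: "qcomm 1 (gx i) (gw j)"
    and qcomm_yw: "qcomm 1 (gy i) (gw j)"
proof -
  show yx: "qcomm (L j i) (gy i) (gx j)" using qcomm_sym[OF qcomm_xy[of j i]] assms by simp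
  show xz: "qcomm 1 (gx i) (gz j)" using qcomm_z[OF qcomm_xx qcomm_xy] assms by simp
  show yz: "qcomm 1 (gy i) (gz j)" using qcomm_z[OF yx qcomm_yy] assms by simp
  show "qcomm 1 (gx i) (gw j)" using qcomm_w[OF xz] by simp
  show "qcomm 1 (gy i) (gw j)" using qcomm_w[OF yz] by simp
qed

lemma
  assumes "i \<noteq> j"
  shows qcomm_wx: "qcomm 1 (gw i) (gx j)"
    and qcomm_wy: "qcomm 1 (gw i) (gy j)"
    and qcomm_wz: "qcomm 1 (gw i) (gz j)"
proof -
  show wx: "qcomm 1 (gw i) (gx j)" using qcomm_sym[OF qcomm_xw[of j i]] assms by simp
  show wy: "qcomm 1 (gw i) (gy j)" using qcomm_sym[OF qcomm_yw[of j i]] assms by simp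
  show "qcomm 1 (gw i) (gz j)" using qcomm_z[OF wx wy] by simp
qed

text \<open>The relation \<open>rel_xy\<close> eliminates xy from z; in \<open>qz_cong_xy\<close> it
  eliminates yx. Comparing the two forms yields the commutation of z with x and y.\<close>

lemma z_cong_yx: "gz i \<approx> scl (q i - 1) (gy i * gx i) + 1"
  using rel_xy[of i]
  by (simp add: gz_eq cong_def algebra_simps pm.scale_left_diff_distrib)

lemma qz_cong_xy: "scl (q i) (gz i) \<approx> scl (q i - 1) (gx i * gy i) + 1"
  using rel_xy[of i]
  by (simp add: gz_eq cong_def algebra_simps pm.scale_left_diff_distrib pm.scale_right_diff_distrib)

lemma yx_cong: "gy i * gx i \<approx> scl (1 / (q i - 1)) (gz i) - scl (1 / (q i - 1)) 1"
proof -
  have "scl (1 / (q i - 1)) (gz i - 1) \<approx> scl (1 / (q i - 1)) (scl (q i - 1) (gy i * gx i) + 1 - 1)"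
    by (intro cong_scl cong_diff z_cong_yx) simp
  then show ?thesis using q_neq_1[of i] by (simp add: cong_sym pm.scale_right_diff_distrib)
qed

lemma xy_cong: "gx i * gy i \<approx> scl (q i / (q i - 1)) (gz i) - scl (1 / (q i - 1)) 1"
proof -
  have "scl (1 / (q i - 1)) (scl (q i) (gz i) - 1)
      \<approx> scl (1 / (q i - 1)) (scl (q i - 1) (gx i * gy i) + 1 - 1)"
    by (intro cong_scl cong_diff qz_cong_xy) simp
  then show ?thesis using q_neq_1[of i] by (simp add: cong_sym pm.scale_right_diff_distrib)
qed

text \<open>Regrouping x(yx) as (xy)x turns the expression of z through yx into that of q z through
  xy.\<close>

lemma qcomm_xz_same: "qcomm (q i) (gx i) (gz i)"
proof -
  have "gx i * gz i \<approx> gx i * (scl (q i - 1) (gy i * gx i) + 1)"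
    by (intro cong_mult_left z_cong_yx)
  also have "\<dots> = (scl (q i - 1) (gx i * gy i) + 1) * gx i" by (simp add: algebra_simps)
  also have "\<dots> \<approx> scl (q i) (gz i) * gx i" by (intro cong_mult_right cong_sym[OF qz_cong_xy])
  finally show ?thesis by (simp add: qcomm_def)
qed

lemma qcomm_yz_same: "qcomm (1 / q i) (gy i) (gz i)"
proof -
  have "gz i * gy i \<approx> (scl (q i - 1) (gy i * gx i) + 1) * gy i"
    by (intro cong_mult_right z_cong_yx)
  also have "\<dots> = gy i * (scl (q i - 1) (gx i * gy i) + 1)" by (simp add: algebra_simps)
  also have "\<dots> \<approx> gy i * scl (q i) (gz i)" by (intro cong_mult_left cong_sym[OF qz_cong_xy])
  finally have "qcomm (q i) (gz i) (gy i)" by (simp add: qcomm_def)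
  then show ?thesis by (rule qcomm_sym) (simp add: q_nz)
qed

section \<open>Powers and blocks in one index\<close>

definition zpow :: "'n \<Rightarrow> int \<Rightarrow> ('n, 'k) fa" where
  "zpow i m = (if m \<ge> 0 then gz i ^ nat m else gw i ^ nat (- m))"

definition vpow :: "'n \<Rightarrow> int \<Rightarrow> ('n, 'k) fa" where
  "vpow i a = (if a \<ge> 0 then gx i ^ nat a else gy i ^ nat (- a))"

definition block :: "'n \<Rightarrow> int \<Rightarrow> int \<Rightarrow> ('n, 'k) fa" where
  "block i m a = zpow i m * vpow i a"

lemma zpow_0 [simp]: "zpow i 0 = 1" and vpow_0 [simp]: "vpow i 0 = 1"
  by (simp_all add: zpow_def vpow_def)

lemma qcomm_zpow:
  assumes "qcomm c p (gz i)" "c \<noteq> 0"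
  shows "\<exists>d. qcomm d p (zpow i m)"
  using qcomm_power[OF assms(1)] qcomm_power[OF qcomm_w[OF assms(1), of "1 / c"]] assms(2)
  by (auto simp: zpow_def)

lemma qcomm_vpow:
  assumes "qcomm c p (gx i)" "qcomm d p (gy i)"
  shows "\<exists>d. qcomm d p (vpow i a)"
  using qcomm_power[OF assms(1)] qcomm_power[OF assms(2)] by (auto simp: vpow_def)

lemma qcomm_block:
  assumes "qcomm c p (gx i)" "qcomm d p (gy i)" "qcomm 1 p (gz i)"
  shows "\<exists>d. qcomm d p (block i m a)"
  using qcomm_zpow[OF assms(3)] qcomm_vpow[OF assms(1,2)] qcomm_mult unfolding block_def
  by (metis zero_neq_one)

lemma zpow_mult_z: "zpow i m * gz i \<approx> zpow i (m + 1)"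
proof (cases "m \<ge> 0")
  case True
  then show ?thesis by (simp add: zpow_def nat_add_distrib power_commutes)
next
  case False
  define k where "k = nat (- m - 1)"
  have k: "nat (- m) = Suc k" using False by (simp add: k_def)
  \<comment> \<open>At m = -1 the exponent m + 1 = 0 falls into the other branch of
    \<open>zpow\<close>; both branches give 1 there.\<close>
  with False have "zpow i (m + 1) = gw i ^ k" by (cases "m = - 1") (auto simp: zpow_def k_def)
  moreover have "zpow i m * gz i = gw i ^ k * (gw i * gz i)"
    using False k by (simp add: zpow_def power_Suc2 mult.assoc del: power_Suc)
  ultimately show ?thesis using cong_mult_left[OF rel_wz, of "gw i ^ k" i] by simp
qed

lemma w_mult_zpow: "gw i * zpow i m \<approx> zpow i (m - 1)"
proof (cases "m > 0")
  case True
  then obtain k where k: "nat m = Suc k" by (cases "nat m") auto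
  with True have "zpow i (m - 1) = gz i ^ k" by (auto simp: zpow_def nat_diff_distrib)
  moreover have "gw i * zpow i m = (gw i * gz i) * gz i ^ k"
    using True k by (simp add: zpow_def mult.assoc)
  ultimately show ?thesis using cong_mult_right[OF rel_wz, of i "gz i ^ k"] by simp
next
  case False
  then have "gw i * zpow i m = gw i ^ Suc (nat (- m))" by (cases "m = 0") (auto simp: zpow_def)
  also have "Suc (nat (- m)) = nat (- (m - 1))" using False by simp
  finally show ?thesis using False by (simp add: zpow_def)
qed

text \<open>Adjoining J to the spanning set makes the span closed under congruence, so it plays the
  role of a span in the quotient without a quotient type.\<close>

definition nspan :: "('n, 'k) fa set \<Rightarrow> ('n, 'k) fa set" where
  "nspan A = pm.span (A \<union> J)"

lemma nspan_base: "p \<in> A \<Longrightarrow> p \<in> nspan A"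
  and nspan_add: "p \<in> nspan A \<Longrightarrow> r \<in> nspan A \<Longrightarrow> p + r \<in> nspan A"
  and nspan_diff: "p \<in> nspan A \<Longrightarrow> r \<in> nspan A \<Longrightarrow> p - r \<in> nspan A"
  and nspan_scl: "p \<in> nspan A \<Longrightarrow> scl c p \<in> nspan A"
  by (simp_all add: nspan_def pm.span_base pm.span_add pm.span_diff pm.span_scale)

lemma nspan_J: "p \<in> J \<Longrightarrow> p \<in> nspan A"
  by (simp add: nspan_def pm.span_base)

lemma nspan_cong: "p \<in> nspan A \<Longrightarrow> r \<approx> p \<Longrightarrow> r \<in> nspan A"
  using nspan_add[of p A "r - p"] nspan_J[of "r - p" A] by (simp add: cong_def)

lemma nspan_mult_left:
  assumes "p \<in> nspan A" "\<And>p. p \<in> A \<Longrightarrow> s * p \<in> nspan B"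
  shows "s * p \<in> nspan B"
  using assms(1) unfolding nspan_def[of A]
proof (induction rule: pm.span_induct_alt)
  case base
  then show ?case by (simp add: nspan_J J_zero)
next
  case (step c p r)
  have "s * p \<in> nspan B" using step(1) assms(2) nspan_J J_mult_left by blast
  then show ?case using step(2) by (simp add: distrib_left nspan_add nspan_scl)
qed

lemma nspan_mult_right:
  assumes "p \<in> nspan A" "\<And>p. p \<in> A \<Longrightarrow> p * s \<in> nspan B"
  shows "p * s \<in> nspan B"
  using assms(1) unfolding nspan_def[of A]
proof (induction rule: pm.span_induct_alt)
  case base
  then show ?case by (simp add: nspan_J J_zero)
next
  case (step c p r)
  have "p * s \<in> nspan B" using step(1) assms(2) nspan_J J_mult_right by blast
  then show ?case using step(2) by (simp add: distrib_right nspan_add nspan_scl)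
qed

section \<open>Left multiplication of blocks by generators\<close>

definition blocks :: "'n \<Rightarrow> ('n, 'k) fa set" where
  "blocks i = range (\<lambda>(m, a). block i m a)"

lemma block_in: "block i m a \<in> nspan (blocks i)"
  by (rule nspan_base) (auto simp: blocks_def)

text \<open>When an x meets a y, the product is affine in z. Such a factor s is absorbed by the
  power of z next to it, leaving a combination of two blocks.\<close>

lemma zpow_affine_vpow_in:
  assumes "s \<approx> scl c (gz i) - scl d 1"
  shows "zpow i m * (s * vpow i a) \<in> nspan (blocks i)"
proof (rule nspan_cong)
  have "zpow i m * (s * vpow i a) \<approx> zpow i m * ((scl c (gz i) - scl d 1) * vpow i a)"
    by (intro cong_mult_left cong_mult_right assms)
  also have "\<dots> = scl c ((zpow i m * gz i) * vpow i a) - scl d (block i m a)"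
    by (simp add: algebra_simps block_def)
  also have "\<dots> \<approx> scl c (block i (m + 1) a) - scl d (block i m a)"
    unfolding block_def[of i "m + 1"] by (intro cong_diff cong_scl cong_mult_right zpow_mult_z) simp
  finally show "zpow i m * (s * vpow i a) \<approx> scl c (block i (m + 1) a) - scl d (block i m a)" .
qed (intro nspan_diff nspan_scl block_in)

text \<open>Up to a scalar, x passes the power of z. It then lengthens a power of x, or cancels one
  y at the cost of an affine factor in z.\<close>

lemma x_mult_block: "gx i * block i m a \<in> nspan (blocks i)"
proof -
  obtain c where c: "qcomm c (gx i) (zpow i m)" using qcomm_zpow[OF qcomm_xz_same] q_nz by blast
  have "gx i * block i m a = (gx i * zpow i m) * vpow i a" by (simp add: block_def mult.assoc)
  also have "\<dots> \<approx> scl c (zpow i m * gx i) * vpow i a"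
    using c by (intro cong_mult_right) (simp add: qcomm_def)
  also have "\<dots> = scl c (zpow i m * (gx i * vpow i a))" by (simp add: mult.assoc)
  finally have *: "gx i * block i m a \<approx> scl c (zpow i m * (gx i * vpow i a))" .
  have "zpow i m * (gx i * vpow i a) \<in> nspan (blocks i)"
  proof (cases "a \<ge> 0")
    case True
    then have "gx i * vpow i a = vpow i (a + 1)" by (simp add: vpow_def nat_add_distrib)
    then show ?thesis using block_in[of i m "a + 1"] by (simp add: block_def)
  next
    case False
    define k where "k = nat (- a - 1)"
    have k: "nat (- a) = Suc k" using False by (simp add: k_def)
    with False have "vpow i (a + 1) = gy i ^ k" by (cases "a = - 1") (auto simp: vpow_def k_def)
    with False k have "gx i * vpow i a = (gx i * gy i) * vpow i (a + 1)"
      by (simp add: vpow_def mult.assoc)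
    then show ?thesis using zpow_affine_vpow_in[OF xy_cong] by simp
  qed
  with * show ?thesis using nspan_scl nspan_cong by blast
qed

lemma y_mult_block: "gy i * block i m a \<in> nspan (blocks i)"
proof -
  obtain c where c: "qcomm c (gy i) (zpow i m)" using qcomm_zpow[OF qcomm_yz_same] q_nz by force
  have "gy i * block i m a = (gy i * zpow i m) * vpow i a" by (simp add: block_def mult.assoc)
  also have "\<dots> \<approx> scl c (zpow i m * gy i) * vpow i a"
    using c by (intro cong_mult_right) (simp add: qcomm_def)
  also have "\<dots> = scl c (zpow i m * (gy i * vpow i a))" by (simp add: mult.assoc)
  finally have *: "gy i * block i m a \<approx> scl c (zpow i m * (gy i * vpow i a))" .
  have "zpow i m * (gy i * vpow i a) \<in> nspan (blocks i)"
  proof (cases "a > 0")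
    case True
    then obtain k where k: "nat a = Suc k" by (cases "nat a") auto
    with True have "vpow i (a - 1) = gx i ^ k" by (auto simp: vpow_def nat_diff_distrib)
    with True k have "gy i * vpow i a = (gy i * gx i) * vpow i (a - 1)"
      by (simp add: vpow_def mult.assoc)
    then show ?thesis using zpow_affine_vpow_in[OF yx_cong] by simp
  next
    case False
    then have "gy i * vpow i a = gy i ^ Suc (nat (- a))" by (cases "a = 0") (auto simp: vpow_def)
    also have "Suc (nat (- a)) = nat (- (a - 1))" using False by simp
    finally have "gy i * vpow i a = vpow i (a - 1)" using False by (simp add: vpow_def)
    then show ?thesis using block_in[of i m "a - 1"] by (simp add: block_def)
  qed
  with * show ?thesis using nspan_scl nspan_cong by blast
qed

lemma w_mult_block: "gw i * block i m a \<in> nspan (blocks i)"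
proof (rule nspan_cong[OF block_in])
  show "gw i * block i m a \<approx> block i (m - 1) a"
    using cong_mult_right[OF w_mult_zpow, of i m "vpow i a"] by (simp add: block_def mult.assoc)
qed

text \<open>The list fixes the order of the blocks and allows induction on the indices. The first
  component of k holds the exponents of z, the second those of v.\<close>

definition nf :: "'n list \<Rightarrow> ('n \<Rightarrow> int) \<times> ('n \<Rightarrow> int) \<Rightarrow> ('n, 'k) fa" where
  "nf is k = prod_list (map (\<lambda>i. block i (fst k i) (snd k i)) is)"

lemma nf_Nil: "nf [] k = 1"
  and nf_Cons: "nf (i # is) k = block i (fst k i) (snd k i) * nf is k"
  by (simp_all add: nf_def)

text \<open>As j is absent from the list, k may be overwritten at j by m and a without changing
  \<open>nf is k\<close>.\<close>

lemma block_mult_nf: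
  assumes "j \<notin> set is"
  shows "block j m a * nf is k \<in> range (nf (j # is))"
proof -
  have "nf is ((fst k)(j := m), (snd k)(j := a)) = nf is k"
    unfolding nf_def using assms by (intro arg_cong[where f = prod_list] map_cong) auto
  then have "block j m a * nf is k = nf (j # is) ((fst k)(j := m), (snd k)(j := a))"
    by (simp add: nf_Cons)
  then show ?thesis by blast
qed

lemma nspan_blocks_mult:
  assumes "j \<notin> set is" "p \<in> nspan (blocks j)" "r \<in> nspan (range (nf is))"
  shows "p * r \<in> nspan (range (nf (j # is)))"
  using assms(2)
proof (rule nspan_mult_right)
  fix b assume "b \<in> blocks j"
  then obtain m a where b: "b = block j m a" by (auto simp: blocks_def)
  show "b * r \<in> nspan (range (nf (j # is)))"
    using assms(3)
    by (rule nspan_mult_left) (use block_mult_nf[OF assms(1)] nspan_base b in blast)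
qed

definition generators :: "'n \<Rightarrow> ('n, 'k) fa set" where
  "generators i = {gx i, gy i, gw i}"

lemma qcomm_generator_block:
  assumes "g \<in> generators i" "i \<noteq> j"
  shows "\<exists>c. qcomm c g (block j m a)"
  using assms(1)
    qcomm_block[OF qcomm_xx[OF assms(2)] qcomm_xy[OF assms(2)] qcomm_xz[OF assms(2)]]
    qcomm_block[OF qcomm_yx[OF assms(2)] qcomm_yy[OF assms(2)] qcomm_yz[OF assms(2)]]
    qcomm_block[OF qcomm_wx[OF assms(2)] qcomm_wy[OF assms(2)] qcomm_wz[OF assms(2)]]
  by (auto simp: generators_def)

text \<open>A generator passes blocks of other indices up to a scalar and is absorbed by the block
  of its own index.\<close>

lemma generator_mult_nspan:
  assumes "distinct is" "i \<in> set is" "g \<in> generators i" "p \<in> nspan (range (nf is))"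
  shows "g * p \<in> nspan (range (nf is))"
  using assms
proof (induction "is" arbitrary: p)
  case Nil
  then show ?case by simp
next
  case (Cons j js)
  show ?case
    using Cons.prems(4)
  proof (rule nspan_mult_left)
    fix r assume "r \<in> range (nf (j # js))"
    then obtain k where r: "r = block j (fst k j) (snd k j) * nf js k" by (auto simp: nf_Cons)
    show "g * r \<in> nspan (range (nf (j # js)))"
    proof (cases "i = j")
      case True
      then have "g * block j (fst k j) (snd k j) \<in> nspan (blocks j)"
        using Cons.prems(3) x_mult_block y_mult_block w_mult_block by (auto simp: generators_def)
      then have "(g * block j (fst k j) (snd k j)) * nf js k \<in> nspan (range (nf (j # js)))"
        by (rule nspan_blocks_mult[rotated]) (use Cons.prems(1) nspan_base in auto)
      then show ?thesis by (simp add: r mult.assoc)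
    next
      case False
      then obtain c where c: "qcomm c g (block j (fst k j) (snd k j))"
        using qcomm_generator_block[OF Cons.prems(3)] by blast
      have "g * nf js k \<in> nspan (range (nf js))"
        using Cons False nspan_base by auto
      then have "block j (fst k j) (snd k j) * (g * nf js k) \<in> nspan (range (nf (j # js)))"
        using nspan_blocks_mult[OF _ block_in] Cons.prems(1) by simp
      moreover have "g * r \<approx> scl c (block j (fst k j) (snd k j) * (g * nf js k))"
        using cong_mult_right[OF c[unfolded qcomm_def], of "nf js k"] by (simp add: r mult.assoc)
      ultimately show ?thesis using nspan_scl nspan_cong by blast
    qed
  qed
qed

definition idx :: "'n list" where "idx = sorted_list_of_set UNIV"

lemma set_idx [simp]: "set idx = UNIV" and distinct_idx [simp]: "distinct idx"
  by (simp_all add: idx_def)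

lemma nf_zero:
  assumes "distinct is"
  shows "nf is ((\<lambda>_. 0), (\<lambda>i. if i = j then e else 0)) = (if j \<in> set is then vpow j e else 1)"
  using assms by (induction "is") (auto simp: nf_Nil nf_Cons block_def)

lemma nf_spans: "p \<in> nspan (range (nf idx))"
proof (induction p rule: fa_generator_induct)
  case one
  show ?case
    using nspan_base[of 1 "range (nf idx)"] nf_zero[of idx _ 0] by (metis distinct_idx rangeI vpow_0)
next
  case (generator g p)
  have "\<exists>i. fa_gen g \<in> generators i"
    by (cases g) (auto simp: generators_def gx_def gy_def gw_def)
  then show ?case using generator_mult_nspan[of idx] generator by auto
qed (simp_all add: nspan_add nspan_scl)

lemma nf_expansion:
  obtains M f where "finite M" "p \<approx> (\<Sum>k\<in>M. scl (f k) (nf idx k))"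
proof -
  have J: "pm.span J = J"
    by (rule pm.span_eq_iff[THEN iffD2]) (simp add: pm.subspace_def J_zero J_add J_scl)
  from nf_spans[of p] obtain s j where sj: "p = s + j" "s \<in> pm.span (range (nf idx))" "j \<in> J"
    unfolding nspan_def pm.span_Un J by auto
  from sj(2) obtain t r where t: "finite t" "t \<subseteq> range (nf idx)" "s = (\<Sum>a\<in>t. scl (r a) a)"
    unfolding pm.span_explicit by auto
  \<comment> \<open>Injectivity of \<open>nf idx\<close> is not established at this point, so one
    index is chosen for each element of t.\<close>
  from t(2) obtain M where M: "t = nf idx ` M" "inj_on (nf idx) M"
    by (meson subset_image_inj)
  have "s = (\<Sum>k\<in>M. scl (r (nf idx k)) (nf idx k))"
    unfolding t(3) M(1) by (simp add: sum.reindex[OF M(2)])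
  moreover have "finite M" using t(1) M by (simp add: finite_image_iff)
  moreover have "p \<approx> s" using sj by (simp add: cong_def)
  ultimately show thesis using that[of M "\<lambda>k. r (nf idx k)"] by simp
qed

end

section \<open>Embedding into a quantum torus\<close>

text \<open>Exponent vectors of the torus, with \<open>False\<close> marking Z-exponents and
  \<open>True\<close> marking X-exponents. Over a linearly ordered index type these form the
  linearly ordered group required by \<open>ordered_twisted_algebra\<close>.\<close>

type_synonym 'n lattice = "bool \<times> 'n \<Rightarrow>\<^sub>0 int"

abbreviation zc :: "'n lattice \<Rightarrow> 'n \<Rightarrow> int" where "zc u i \<equiv> lk u (False, i)"
abbreviation xc :: "'n lattice \<Rightarrow> 'n \<Rightarrow> int" where "xc u i \<equiv> lk u (True, i)"
abbreviation eZ :: "'n \<Rightarrow> 'n lattice" where "eZ i \<equiv> sgl (False, i) 1"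
abbreviation eX :: "'n \<Rightarrow> 'n lattice" where "eX i \<equiv> sgl (True, i) 1"

lemma lattice_eqI: "(\<And>i. zc u i = zc v i) \<Longrightarrow> (\<And>i. xc u i = xc v i) \<Longrightarrow> u = v"
  by (rule poly_mapping_eqI) (metis (full_types) surj_pair)

lemma single_pos: "0 < c \<Longrightarrow> 0 < (sgl k c :: 'a::linorder \<Rightarrow>\<^sub>0 int)"
  by transfer (auto simp: less_fun_def when_def)

text \<open>Homogeneity for the grading by X-exponents. The element 0 is homogeneous of every
  degree, so nonvanishing is stated separately where it matters.\<close>

definition xdeg :: "('n lattice \<Rightarrow>\<^sub>0 'k::zero) \<Rightarrow> ('n \<Rightarrow> int) \<Rightarrow> bool" where
  "xdeg t a \<longleftrightarrow> (\<forall>u\<in>ks t. \<forall>j. xc u j = a j)"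

context quantum_weyl
begin

text \<open>The basis element of the torus indexed by $u$ stands for $Z^m X^a$ with $m$ = \<open>zc u\<close> and
  $a$ = \<open>xc u\<close>, the $X_i$ being multiplied in decreasing order of $i$; moving $X_i$ to the right
  past $Z_i$ contributes $q_i$.\<close>

definition chi :: "'n lattice \<Rightarrow> 'n lattice \<Rightarrow> 'k" where
  "chi u v = (\<Prod>i\<in>UNIV. q i powi (xc u i * zc v i)) *
     (\<Prod>(i, j)\<in>{(i, j). i < j}. L i j powi (xc u i * xc v j))"

text \<open>\<open>chi\<close> is a bicharacter. This gives the cocycle law and reduces its values
  to those on \<open>eZ\<close> and \<open>eX\<close>.\<close>

lemma chi_add_left: "chi (u + u') v = chi u v * chi u' v"
  by (simp add: chi_def lookup_add distrib_right power_int_add q_nz L_nz prod.distrib case_prod_beta)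

lemma chi_add_right: "chi u (v + v') = chi u v * chi u v'"
  by (simp add: chi_def lookup_add distrib_left power_int_add q_nz L_nz prod.distrib case_prod_beta)

lemma chi_nonzero: "chi u v \<noteq> 0"
  by (simp add: chi_def q_nz L_nz case_prod_beta)

lemma chi_zero_left: "chi 0 v = 1" and chi_zero_right: "chi u 0 = 1"
  by (simp_all add: chi_def)

lemma chi_uminus_left: "chi (- u) v = inverse (chi u v)"
  using chi_add_left[of u "- u" v] by (simp add: chi_zero_left inverse_unique)

lemma chi_uminus_right: "chi u (- v) = inverse (chi u v)"
  using chi_add_right[of u v "- v"] by (simp add: chi_zero_right inverse_unique)

lemma chi_diff_left: "chi (u - u') v = chi u v * inverse (chi u' v)"
  using chi_add_left[of u "- u'" v] by (simp add: chi_uminus_left)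

lemma chi_diff_right: "chi u (v - v') = chi u v * inverse (chi u v')"
  using chi_add_right[of u v "- v'"] by (simp add: chi_uminus_right)

text \<open>A Z-monomial on the left is already in standard order.\<close>

lemma chi_left_xc_zero: "(\<And>j. xc u j = 0) \<Longrightarrow> chi u v = 1"
  by (simp add: chi_def)

lemma chi_right_xc_zero: "(\<And>j. xc v j = 0) \<Longrightarrow> chi u v = (\<Prod>i\<in>UNIV. q i powi (xc u i * zc v i))"
  by (simp add: chi_def)

lemma chi_eZ_left: "chi (eZ i) v = 1"
  by (rule chi_left_xc_zero) (simp add: lookup_single)

lemma chi_eX_eZ: "chi (eX i) (eZ j) = (if i = j then q i else 1)"
proof -
  have "chi (eX i) (eZ j) = (\<Prod>k\<in>UNIV. q k powi (xc (eX i) k * zc (eZ j) k))"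
    by (rule chi_right_xc_zero) (simp add: lookup_single)
  also have "\<dots> = (\<Prod>k\<in>UNIV. if k = i then (if i = j then q i else 1) else 1)"
    by (intro prod.cong refl) (auto simp: lookup_single when_def)
  finally show ?thesis by simp
qed

lemma chi_eX_eX: "chi (eX i) (eX j) = (if i < j then L i j else 1)"
proof -
  have "chi (eX i) (eX j)
      = (\<Prod>(k, l)\<in>{(i, j). i < j}. L k l powi (xc (eX i) k * xc (eX j) l))"
    by (simp add: chi_def lookup_single)
  also have "\<dots> = (\<Prod>k\<in>{(i, j). i < j}. if k = (i, j) then L i j else 1)"
    by (intro prod.cong refl) (auto simp: lookup_single when_def split: if_splits)
  finally show ?thesis by simp
qed

lemmas chi_simps = chi_add_left chi_add_right chi_uminus_left chi_uminus_right chi_diff_left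
  chi_diff_right chi_eZ_left chi_eX_eZ chi_eX_eX chi_zero_left chi_zero_right

sublocale T: ordered_twisted_algebra chi
  by unfold_locales (simp_all add: chi_simps chi_nonzero)

notation T.tmult (infixl \<open>\<odot>\<close> 70)

text \<open>With x and z sent to X and Z, the image of y is dictated by yx = (z - 1)/(q -
  1).\<close>

definition rho_gen :: "'n gen \<Rightarrow> 'n lattice \<Rightarrow>\<^sub>0 'k" where
  "rho_gen g = (case g of X i \<Rightarrow> sgl (eX i) 1
     | Y i \<Rightarrow> sgl (eZ i - eX i) (1 / (q i - 1)) - sgl (- eX i) (1 / (q i - 1))
     | W i \<Rightarrow> sgl (- eZ i) 1)"

definition rho :: "('n, 'k) fa \<Rightarrow> 'n lattice \<Rightarrow>\<^sub>0 'k" where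
  "rho = lext (T.tword rho_gen)"

lemma rho_hom: "T.algebra_hom rho"
  by (simp add: rho_def T.algebra_hom_lext)

lemmas rho_simps = T.hom_add[OF rho_hom] T.hom_diff[OF rho_hom] T.hom_mult[OF rho_hom]
  T.hom_scl[OF rho_hom] T.hom_one[OF rho_hom] T.hom_zero[OF rho_hom]

lemma rho_x: "rho (gx i) = sgl (eX i) 1"
  and rho_y: "rho (gy i) = sgl (eZ i - eX i) (1 / (q i - 1)) - sgl (- eX i) (1 / (q i - 1))"
  and rho_w: "rho (gw i) = sgl (- eZ i) 1"
  by (simp_all add: rho_def gx_def gy_def gw_def rho_gen_def)

lemma rho_xy: "rho (gx i * gy i) = sgl (eZ i) (q i / (q i - 1)) - sgl 0 (1 / (q i - 1))"
  by (simp add: rho_simps rho_x rho_y T.tmult_diff_right T.tmult_single chi_simps)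

lemma rho_yx: "rho (gy i * gx i) = sgl (eZ i) (1 / (q i - 1)) - sgl 0 (1 / (q i - 1))"
  by (simp add: rho_simps rho_x rho_y T.tmult_diff_left T.tmult_single chi_simps)

lemma rho_z: "rho (gz i) = sgl (eZ i) 1"
proof -
  have "q i / (q i - 1) - 1 / (q i - 1) = 1"
    using q_neq_1[of i] by (simp flip: diff_divide_distrib)
  then show ?thesis
    by (simp add: gz_eq T.hom_diff[OF rho_hom] rho_xy rho_yx flip: single_diff)
qed

lemma keys_rho_y: "ks (rho (gy i)) \<subseteq> {eZ i - eX i, - eX i}"
  unfolding rho_y by (rule order_trans[OF keys_diff]) auto

text \<open>A commutation relation only requires comparing \<open>chi\<close> on the few exponents
  of the two factors; the other relations are direct computations.\<close>

lemma rho_rels: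
  assumes "r \<in> AZ_rels q L"
  shows "rho r = 0"
proof -
  have comm: "rho (p * s) - scl c (rho (s * p)) = 0"
    if "\<And>u v. u \<in> ks (rho p) \<Longrightarrow> v \<in> ks (rho s) \<Longrightarrow> chi u v = c * chi v u" for p s c
    unfolding T.hom_mult[OF rho_hom] using T.tmult_twisted_commute[OF that] by simp
  have xx: "rho (gx i * gx j) - scl (L i j) (rho (gx j * gx i)) = 0" if "i < j" for i j
    by (rule comm) (use that in \<open>auto simp: rho_x chi_simps\<close>)
  have yy: "rho (gy j * gy i) - scl (L j i) (rho (gy i * gy j)) = 0" if "i < j" for i j
  proof (rule comm)
    fix u v assume "u \<in> ks (rho (gy j))" "v \<in> ks (rho (gy i))"
    then have "u \<in> {eZ j - eX j, - eX j}" "v \<in> {eZ i - eX i, - eX i}" using keys_rho_y by blast+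
    then show "chi u v = L j i * chi v u"
      using that L_nz by (auto simp: chi_simps)
  qed
  have xy: "rho (gx i * gy j) - scl (L j i) (rho (gy j * gx i)) = 0" if "i \<noteq> j" for i j
  proof (rule comm)
    fix u v assume "u \<in> ks (rho (gx i))" "v \<in> ks (rho (gy j))"
    then have "u = eX i" "v \<in> {eZ j - eX j, - eX j}" using keys_rho_y by (auto simp: rho_x)
    then show "chi u v = L j i * chi v u"
      using that L_nz L_inv[of j i] by (auto simp: chi_simps)
  qed
  have "rho (gx i * gy i) - scl (q i) (rho (gy i * gx i)) - 1 = 0" for i
  proof -
    have "q i / (q i - 1) - 1 / (q i - 1) = 1"
      using q_neq_1[of i] by (simp flip: diff_divide_distrib)
    then show ?thesis
      by (intro poly_mapping_eqI)
         (auto simp: rho_xy rho_yx lookup_minus lookup_add lookup_single lookup_one when_def algebra_simps)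
  qed
  moreover have "rho (gw i * gz i) - 1 = 0" "rho (gz i * gw i) - 1 = 0" for i
    by (simp_all add: rho_simps rho_w rho_z T.tmult_single chi_simps)
  ultimately show ?thesis
    using assms xx yy xy unfolding AZ_rels_def A_rels_def
    by (auto simp: fa_mult_eq_times fa_scal_eq_scl fa_one_eq T.hom_diff[OF rho_hom]
        T.hom_scl[OF rho_hom] T.hom_one[OF rho_hom])
qed

lemma rho_J: "p \<in> J \<Longrightarrow> rho p = 0"
  unfolding AZ_ideal_def by (rule T.hom_vanishes_on_ideal[OF rho_hom rho_rels])

section \<open>Leading exponents of normal forms\<close>

text \<open>The common properties of \<open>mx\<close> and \<open>mn\<close>, so that exponents of
  normal forms are computed once for both.\<close>

definition valuation :: "(('n lattice \<Rightarrow>\<^sub>0 'k) \<Rightarrow> 'n lattice) \<Rightarrow> bool" where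
  "valuation v \<longleftrightarrow> v 1 = 0 \<and> (\<forall>p r. p \<noteq> 0 \<longrightarrow> r \<noteq> 0 \<longrightarrow> v (p \<odot> r) = v p + v r)"

lemma valuation_mx: "valuation T.mx" and valuation_mn: "valuation T.mn"
  by (simp_all add: valuation_def T.mx_one T.mn_one T.mx_tmult T.mn_tmult)

text \<open>Coordinate \<kappa> of the valuation of the image of a block, as
  \<open>val_block\<close> confirms. For negative a the factor - a is the power of y in
  \<open>vpow\<close>.\<close>

definition exponent :: "(('n lattice \<Rightarrow>\<^sub>0 'k) \<Rightarrow> 'n lattice) \<Rightarrow> (('n, 'k) fa \<Rightarrow> 'n lattice \<Rightarrow>\<^sub>0 'k) \<Rightarrow>
    'n \<Rightarrow> int \<Rightarrow> int \<Rightarrow> bool \<times> 'n \<Rightarrow> int" where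
  "exponent v h i m a \<kappa> = m * lk (v (h (gz i))) \<kappa> +
     (if a \<ge> 0 then a * lk (v (h (gx i))) \<kappa> else - a * lk (v (h (gy i))) \<kappa>)"

section \<open>Homomorphisms to the torus that kill the ideal: \<open>rho\<close>, and later
  \<open>\<theta>\<close>\<close>

context
  fixes h :: "('n, 'k) fa \<Rightarrow> 'n lattice \<Rightarrow>\<^sub>0 'k"
  assumes h: "T.algebra_hom h" and h_J: "\<And>p. p \<in> J \<Longrightarrow> h p = 0"
begin

lemma hom_cong: "p \<approx> r \<Longrightarrow> h p = h r"
  using h_J[of "p - r"] by (simp add: cong_def T.hom_diff[OF h])

lemma hom_qcomm: "qcomm c p r \<Longrightarrow> h p \<odot> h r = scl c (h r \<odot> h p)"
  unfolding qcomm_def by (drule hom_cong) (simp add: T.hom_mult[OF h] T.hom_scl[OF h])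

lemma hom_wz: "h (gw i) \<odot> h (gz i) = 1" and hom_zw: "h (gz i) \<odot> h (gw i) = 1"
  using hom_cong[OF rel_wz] hom_cong[OF rel_zw] by (simp_all add: T.hom_mult[OF h] T.hom_one[OF h])

lemma hom_yx: "h (gy i) \<odot> h (gx i) = scl (1 / (q i - 1)) (h (gz i)) - scl (1 / (q i - 1)) 1"
  using hom_cong[OF yx_cong[of i]]
  by (simp add: T.hom_mult[OF h] T.hom_one[OF h] T.hom_scl[OF h] T.hom_diff[OF h])

lemma hom_z_nz: "h (gz i) \<noteq> 0" and hom_w_nz: "h (gw i) \<noteq> 0"
  using hom_wz[of i] by auto

text \<open>If x or y were sent to 0, the relation xy - q yx = 1 would become 0 = 1.\<close>

lemma hom_x_nz: "h (gx i) \<noteq> 0" and hom_y_nz: "h (gy i) \<noteq> 0"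
  using hom_cong[OF rel_xy[of i]]
  by (auto simp: T.hom_mult[OF h] T.hom_one[OF h] T.hom_scl[OF h] T.hom_add[OF h])

context
  fixes v
  assumes v: "valuation v"
begin

lemma val_power:
  assumes "h p \<noteq> 0"
  shows "h (p ^ k) \<noteq> 0 \<and> lk (v (h (p ^ k))) \<kappa> = int k * lk (v (h p)) \<kappa>"
  using assms v
  by (induction k)
     (auto simp: T.hom_one[OF h] T.hom_mult[OF h] T.tmult_nonzero valuation_def lookup_add algebra_simps)

lemma val_w: "lk (v (h (gw i))) \<kappa> = - lk (v (h (gz i))) \<kappa>"
proof -
  have "v (h (gw i)) + v (h (gz i)) = 0"
    using v hom_wz[of i] hom_w_nz[of i] hom_z_nz[of i] unfolding valuation_def by metis
  then show ?thesis by (metis eq_neg_iff_add_eq_0 lookup_uminus)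
qed

lemma val_block: "h (block i m a) \<noteq> 0 \<and> lk (v (h (block i m a))) \<kappa> = exponent v h i m a \<kappa>"
proof -
  have z: "h (zpow i m) \<noteq> 0 \<and> lk (v (h (zpow i m))) \<kappa> = m * lk (v (h (gz i))) \<kappa>"
    using val_power[OF hom_z_nz] val_power[OF hom_w_nz] by (simp add: zpow_def val_w)
  have x: "h (vpow i a) \<noteq> 0 \<and> lk (v (h (vpow i a))) \<kappa> =
      (if a \<ge> 0 then a * lk (v (h (gx i))) \<kappa> else - a * lk (v (h (gy i))) \<kappa>)"
    using val_power[OF hom_x_nz] val_power[OF hom_y_nz] by (simp add: vpow_def)
  show ?thesis
    using z x v
    by (simp add: block_def T.hom_mult[OF h] T.tmult_nonzero valuation_def lookup_add exponent_def)
qed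

lemma val_nf:
  assumes "distinct is"
  shows "h (nf is k) \<noteq> 0 \<and>
    lk (v (h (nf is k))) \<kappa> = (\<Sum>i\<in>set is. exponent v h i (fst k i) (snd k i) \<kappa>)"
  using assms
proof (induction "is")
  case Nil
  then show ?case using v by (simp add: nf_Nil T.hom_one[OF h] valuation_def)
next
  case (Cons i "is")
  then show ?case
    using v val_block[of i "fst k i" "snd k i"]
    by (simp add: nf_Cons T.hom_mult[OF h] T.tmult_nonzero valuation_def lookup_add)
qed

end

lemma hom_nf_nz: "h (nf idx k) \<noteq> 0"
  using val_nf[OF valuation_mx distinct_idx] by blast

text \<open>The X-coordinates of the leading exponent determine the exponents of v. These fix what x
  and y contribute to the Z-coordinates, and the remainder determines the exponents of z. For
  \<open>rho\<close> all \<epsilon> are 1; for \<open>\<theta>\<close> they are signs.\<close>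

lemma mx_nf_inj:
  assumes \<epsilon>: "\<And>i. \<epsilon> i \<noteq> 0"
    and z: "\<And>i. T.mx (h (gz i)) = sgl (False, i) (\<epsilon> i)"
    and x: "\<And>i j. xc (T.mx (h (gx i))) j = (if j = i then \<epsilon> i else 0)"
    and y: "\<And>i j. xc (T.mx (h (gy i))) j = (if j = i then - \<epsilon> i else 0)"
  shows "inj (\<lambda>k. T.mx (h (nf idx k)))"
proof (rule injI)
  fix k l assume eq: "T.mx (h (nf idx k)) = T.mx (h (nf idx l))"
  note val = val_nf[OF valuation_mx distinct_idx, THEN conjunct2]
  have xc: "xc (T.mx (h (nf idx k))) j = \<epsilon> j * snd k j" for k j
  proof -
    have "xc (T.mx (h (nf idx k))) j = (\<Sum>i\<in>UNIV. if i = j then \<epsilon> j * snd k j else 0)"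
      unfolding val set_idx by (intro sum.cong refl) (simp add: exponent_def z x y lookup_single)
    then show ?thesis by simp
  qed
  have "snd k j = snd l j" for j using xc[of k j] xc[of l j] eq \<epsilon>[of j] by simp
  then have snd: "snd k = snd l" by (rule ext)
  have zc: "zc (T.mx (h (nf idx k))) j = \<epsilon> j * fst k j +
     (\<Sum>i\<in>UNIV. if snd k i \<ge> 0 then snd k i * zc (T.mx (h (gx i))) j
       else - snd k i * zc (T.mx (h (gy i))) j)" for k j
  proof -
    have "(\<Sum>i\<in>UNIV. fst k i * zc (T.mx (h (gz i))) j) = (\<Sum>i\<in>UNIV. if i = j then \<epsilon> j * fst k j else 0)"
      by (intro sum.cong refl) (simp add: z lookup_single when_def)
    then show ?thesis unfolding val by (simp add: exponent_def sum.distrib)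
  qed
  have "fst k j = fst l j" for j using zc[of k j, unfolded snd eq] zc[of l j] \<epsilon>[of j] by simp
  with snd show "k = l" by (simp add: prod_eq_iff fun_eq_iff)
qed

text \<open>Images of normal forms with distinct leading exponents are linearly independent, so an
  element of the kernel has only zero coefficients in its expansion.\<close>

lemma hom_kernel:
  assumes inj: "inj (\<lambda>k. T.mx (h (nf idx k)))" and "h p = 0"
  shows "p \<in> J"
proof -
  obtain M f where M: "finite M" "p \<approx> (\<Sum>k\<in>M. scl (f k) (nf idx k))" by (rule nf_expansion)
  \<comment> \<open>\<open>sum_distinct_mx\<close> needs nonzero coefficients, so the vanishing ones
    are dropped first.\<close>
  define N where "N = {k \<in> M. f k \<noteq> 0}"
  have sum: "(\<Sum>k\<in>M. scl (f k) (g k)) = (\<Sum>k\<in>N. scl (f k) (g k))" for g :: "_ \<Rightarrow> 'a \<Rightarrow>\<^sub>0 'k"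
    using M(1) by (intro sum.mono_neutral_right) (auto simp: N_def)
  have N: "p \<approx> (\<Sum>k\<in>N. scl (f k) (nf idx k))" using M(2) by (simp add: sum)
  from hom_cong[OF this] have "(\<Sum>k\<in>N. scl (f k) (h (nf idx k))) = 0"
    using assms(2) by (simp add: T.hom_sum[OF h] T.hom_scl[OF h])
  moreover have "(\<Sum>k\<in>N. scl (f k) (h (nf idx k))) \<noteq> 0" if "N \<noteq> {}"
    using that M(1) hom_nf_nz inj_on_subset[OF inj subset_UNIV]
    by (intro T.sum_distinct_mx[THEN conjunct1]) (simp_all add: N_def)
  ultimately have "N = {}" by blast
  then show ?thesis using N by (simp add: cong_def)
qed

end

section \<open>Extremal exponents under \<open>rho\<close>, and its kernel\<close>

lemma mx_rho_x: "T.mx (rho (gx i)) = eX i" and mn_rho_x: "T.mn (rho (gx i)) = eX i"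
  and mx_rho_z: "T.mx (rho (gz i)) = eZ i" and mn_rho_z: "T.mn (rho (gz i)) = eZ i"
  by (simp_all add: rho_x rho_z T.mx_single T.mn_single)

lemma mx_rho_y: "T.mx (rho (gy i)) = eZ i - eX i" and mn_rho_y: "T.mn (rho (gy i)) = - eX i"
proof -
  have less: "- eX i < eZ i - eX i" using single_pos[of 1 "(False, i)"] by simp
  then have keys: "ks (rho (gy i)) = {eZ i - eX i, - eX i}"
    using keys_rho_y[of i] q_neq_1[of i]
    by (auto simp: rho_y in_keys_iff lookup_minus lookup_single when_def)
  show "T.mx (rho (gy i)) = eZ i - eX i" "T.mn (rho (gy i)) = - eX i"
    using less by (simp_all add: T.mx_def T.mn_def keys)
qed

lemma rho_mx_inj: "inj (\<lambda>k. T.mx (rho (nf idx k)))"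
  by (rule mx_nf_inj[OF rho_hom rho_J, where \<epsilon> = "\<lambda>_. 1"])
     (auto simp: mx_rho_x mx_rho_y mx_rho_z lookup_minus lookup_single)

lemma rho_kernel: "rho p = 0 \<Longrightarrow> p \<in> J"
  by (rule hom_kernel[OF rho_hom rho_J rho_mx_inj])

end

context quantum_weyl
begin

section \<open>Homogeneous elements of the image\<close>

lemma xdeg_tmult:
  assumes "xdeg t a" "xdeg s b"
  shows "xdeg (t \<odot> s) (\<lambda>j. a j + b j)"
  using assms unfolding xdeg_def by (auto elim!: T.keys_tmult simp: lookup_add)

lemma xdeg_one: "xdeg 1 (\<lambda>_. 0)"
  by (simp add: xdeg_def)

lemma xdeg_rho_power: "xdeg (rho p) a \<Longrightarrow> xdeg (rho (p ^ k)) (\<lambda>j. int k * a j)"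
proof (induction k)
  case (Suc k)
  from xdeg_tmult[OF Suc.prems Suc.IH[OF Suc.prems]] show ?case
    by (simp add: rho_simps distrib_right)
qed (simp add: xdeg_one rho_simps)

lemma xdeg_rho_x: "xdeg (rho (gx i)) (\<lambda>j. if j = i then 1 else 0)"
  by (auto simp: xdeg_def rho_x lookup_single when_def)

lemma xdeg_rho_y: "xdeg (rho (gy i)) (\<lambda>j. if j = i then - 1 else 0)"
  using keys_rho_y[of i] by (auto simp: xdeg_def lookup_minus lookup_single when_def)

lemma xdeg_rho_vpow: "xdeg (rho (vpow i a)) (\<lambda>j. if j = i then a else 0)"
proof (cases "a \<ge> 0")
  case True
  then have "(\<lambda>j. int (nat a) * (if j = i then 1 else 0)) = (\<lambda>j. if j = i then a else 0)" by auto
  then show ?thesis using xdeg_rho_power[OF xdeg_rho_x, of i "nat a"] True by (simp add: vpow_def)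
next
  case False
  then have "(\<lambda>j. int (nat (- a)) * (if j = i then - 1 else 0)) = (\<lambda>j. if j = i then a else 0)" by auto
  then show ?thesis using xdeg_rho_power[OF xdeg_rho_y, of i "nat (- a)"] False by (simp add: vpow_def)
qed

lemma rho_zpow: "rho (zpow i m) = sgl (sgl (False, i) m) 1"
proof -
  have "rho (gz i ^ k) = sgl (sgl (False, i) (int k)) 1" for k
    by (induction k) (simp_all add: rho_simps rho_z T.tmult_single chi_eZ_left single_add)
  moreover have "rho (gw i ^ k) = sgl (sgl (False, i) (- int k)) 1" for k
  proof (induction k)
    case (Suc k)
    have "- eZ i + sgl (False, i) (- int k) = sgl (False, i) (- int (Suc k))"
      by (simp flip: single_uminus single_add)
    with Suc show ?case
      by (simp add: rho_simps rho_w T.tmult_single chi_uminus_left chi_eZ_left)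
  qed (simp add: rho_simps)
  ultimately show ?thesis by (simp add: zpow_def)
qed

lemma xdeg_rho_nf:
  assumes "distinct is"
  shows "xdeg (rho (nf is (m, a))) (\<lambda>j. if j \<in> set is then a j else 0)"
  using assms
proof (induction "is")
  case Nil
  then show ?case by (simp add: nf_Nil rho_simps xdeg_one)
next
  case (Cons i "is")
  have "xdeg (rho (zpow i (m i))) (\<lambda>_. 0)" by (simp add: rho_zpow xdeg_def lookup_single)
  from xdeg_tmult[OF xdeg_tmult[OF this xdeg_rho_vpow[of i "a i"]] Cons.IH] Cons.prems
  have "xdeg (rho (nf (i # is) (m, a)))
      (\<lambda>j. 0 + (if j = i then a i else 0) + (if j \<in> set is then a j else 0))"
    by (simp add: nf_Cons block_def rho_simps)
  also have "(\<lambda>j. 0 + (if j = i then a i else 0) + (if j \<in> set is then a j else 0))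
      = (\<lambda>j. if j \<in> set (i # is) then a j else 0)"
    using Cons.prems by (auto simp: fun_eq_iff)
  finally show ?case .
qed

text \<open>Additive on products and, for nonzero elements, 0 exactly on monomials.\<close>

definition width :: "('n lattice \<Rightarrow>\<^sub>0 'k) \<Rightarrow> 'n lattice" where
  "width t = T.mx t - T.mn t"

lemma width_nonneg: "t \<noteq> 0 \<Longrightarrow> 0 \<le> width t"
  using T.mn_le_mx by (simp add: width_def)

lemma width_tmult: "t \<noteq> 0 \<Longrightarrow> s \<noteq> 0 \<Longrightarrow> width (t \<odot> s) = width t + width s"
  by (simp add: width_def T.mx_tmult T.mn_tmult)

text \<open>Powers of z shift both extremal exponents equally, so they are taken to be 0 here;
  \<open>width_rho_nf\<close> covers the general case.\<close>

definition nf_width :: "('n \<Rightarrow> int) \<Rightarrow> 'n lattice" where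
  "nf_width a = width (rho (nf idx ((\<lambda>_. 0), a)))"

lemma val_rho_nf:
  assumes "valuation v"
  shows "lk (v (rho (nf idx k))) \<kappa> = (\<Sum>i\<in>UNIV. exponent v rho i (fst k i) (snd k i) \<kappa>)"
  using val_nf[OF rho_hom rho_J assms distinct_idx] by simp

text \<open>The images of x and z are monomials, while each factor y adds width
  \<open>eZ i\<close>.\<close>

lemma lookup_width_rho_nf:
  "zc (width (rho (nf idx (m, a)))) j = max 0 (- a j)" "xc (width (rho (nf idx (m, a)))) j = 0"
proof -
  have *: "lk (width (rho (nf idx (m, a)))) \<kappa> = (\<Sum>i\<in>UNIV. max 0 (- a i) * lk (eZ i) \<kappa>)" for \<kappa>
    unfolding width_def lookup_minus val_rho_nf[OF valuation_mx] val_rho_nf[OF valuation_mn]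
      sum_subtractf[symmetric]
    by (intro sum.cong refl)
       (simp add: exponent_def mx_rho_x mx_rho_y mx_rho_z mn_rho_x mn_rho_y mn_rho_z lookup_minus
         algebra_simps)
  have "zc (width (rho (nf idx (m, a)))) j = (\<Sum>i\<in>UNIV. if i = j then max 0 (- a j) else 0)"
    unfolding * by (intro sum.cong refl) (simp add: lookup_single when_def)
  then show "zc (width (rho (nf idx (m, a)))) j = max 0 (- a j)" by simp
  show "xc (width (rho (nf idx (m, a)))) j = 0" unfolding * by (simp add: lookup_single)
qed

lemma zc_nf_width: "zc (nf_width a) j = max 0 (- a j)" and xc_nf_width: "xc (nf_width a) j = 0"
  by (simp_all add: nf_width_def lookup_width_rho_nf)

lemma width_rho_nf: "width (rho (nf idx (m, a))) = nf_width a"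
  by (rule lattice_eqI) (simp_all add: lookup_width_rho_nf zc_nf_width xc_nf_width)

lemma rho_nf_nz: "rho (nf idx k) \<noteq> 0"
  by (rule hom_nf_nz[OF rho_hom rho_J])

text \<open>All normal forms of X-degree a have the same width. Hence the width of a combination
  exceeds it by the distance between its highest and lowest leading exponents, and equality leaves
  room for one normal form only.\<close>

lemma homogeneous_width:
  assumes "rho p \<noteq> 0" "xdeg (rho p) a"
  shows "nf_width a \<le> width (rho p)"
    and "width (rho p) = nf_width a \<Longrightarrow> \<exists>m c. c \<noteq> 0 \<and> rho p = scl c (rho (nf idx (m, a)))"
proof -
  obtain M f where M: "finite M" "p \<approx> (\<Sum>k\<in>M. scl (f k) (nf idx k))" by (rule nf_expansion)
  define N where "N = {k \<in> M. f k \<noteq> 0 \<and> snd k = a}"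
  have fin: "finite N" using M(1) by (simp add: N_def)
  have nf_xdeg: "xc u j = snd k j" if "u \<in> ks (rho (nf idx k))" for u k j
    using xdeg_rho_nf[OF distinct_idx, of "fst k" "snd k"] that by (simp add: xdeg_def)
  \<comment> \<open>Normal forms with other exponents of v live in other X-degrees and cannot
    contribute to a homogeneous element.\<close>
  have sum: "rho p = (\<Sum>k\<in>N. scl (f k) (rho (nf idx k)))"
  proof (rule poly_mapping_eqI)
    fix u
    have "lk (rho p) u = (\<Sum>k\<in>M. f k * lk (rho (nf idx k)) u)"
      using hom_cong[OF rho_hom rho_J M(2)]
      by (simp add: T.hom_sum[OF rho_hom] rho_simps lookup_sum)
    also have "\<dots> = (\<Sum>k\<in>N. f k * lk (rho (nf idx k)) u)" if "\<forall>j. xc u j = a j"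
    proof (rule sum.mono_neutral_right[OF M(1)])
      show "\<forall>k\<in>M - N. f k * lk (rho (nf idx k)) u = 0"
        using nf_xdeg that by (force simp: N_def in_keys_iff fun_eq_iff)
    qed (auto simp: N_def)
    finally have "lk (rho p) u = (\<Sum>k\<in>N. f k * lk (rho (nf idx k)) u)" if "\<forall>j. xc u j = a j"
      using that .
    moreover have "lk (rho p) u = 0" "(\<Sum>k\<in>N. f k * lk (rho (nf idx k)) u) = 0"
      if "\<not> (\<forall>j. xc u j = a j)"
    proof -
      show "lk (rho p) u = 0" using assms(2) that by (auto simp: xdeg_def in_keys_iff)
      have "u \<notin> ks (rho (nf idx k))" if "k \<in> N" for k
        using nf_xdeg[of u k] \<open>\<not> (\<forall>j. xc u j = a j)\<close> that unfolding N_def by blast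
      then show "(\<Sum>k\<in>N. f k * lk (rho (nf idx k)) u) = 0"
        by (intro sum.neutral) (auto simp: in_keys_iff)
    qed
    ultimately show "lk (rho p) u = lk (\<Sum>k\<in>N. scl (f k) (rho (nf idx k))) u"
      by (cases "\<forall>j. xc u j = a j") (simp_all add: lookup_sum)
  qed
  have "N \<noteq> {}" using sum assms(1) by auto
  have f: "f k \<noteq> 0" if "k \<in> N" for k using that by (simp add: N_def)
  have width: "T.mx (rho (nf idx k)) = T.mn (rho (nf idx k)) + nf_width a" if "k \<in> N" for k
    using width_rho_nf[of "fst k" "snd k"] that by (auto simp: N_def width_def algebra_simps)
  have inj_mx: "inj_on (\<lambda>k. T.mx (rho (nf idx k))) N"
    using rho_mx_inj by (rule inj_on_subset) simp
  then have inj_mn: "inj_on (\<lambda>k. T.mn (rho (nf idx k))) N"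
    using width unfolding inj_on_def by simp
  have "\<exists>k\<in>N. T.mx (rho p) = T.mx (rho (nf idx k)) \<and>
      (\<forall>l\<in>N. T.mx (rho (nf idx l)) \<le> T.mx (rho (nf idx k)))"
    unfolding sum
    by (rule T.sum_distinct_mx[THEN conjunct2]) (simp_all add: fin \<open>N \<noteq> {}\<close> f rho_nf_nz inj_mx)
  then obtain k where k: "k \<in> N" "T.mx (rho p) = T.mx (rho (nf idx k))"
    "\<And>l. l \<in> N \<Longrightarrow> T.mx (rho (nf idx l)) \<le> T.mx (rho (nf idx k))"
    by blast
  have "\<exists>l\<in>N. T.mn (rho p) = T.mn (rho (nf idx l)) \<and>
      (\<forall>k\<in>N. T.mn (rho (nf idx l)) \<le> T.mn (rho (nf idx k)))"
    unfolding sum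
    by (rule T.sum_distinct_mn[THEN conjunct2]) (simp_all add: fin \<open>N \<noteq> {}\<close> f rho_nf_nz inj_mn)
  then obtain l where l: "l \<in> N" "T.mn (rho p) = T.mn (rho (nf idx l))"
    "\<And>k. k \<in> N \<Longrightarrow> T.mn (rho (nf idx l)) \<le> T.mn (rho (nf idx k))"
    by blast
  have eq: "width (rho p) = nf_width a + (T.mx (rho (nf idx k)) - T.mx (rho (nf idx l)))"
    using width[OF l(1)] by (simp add: width_def k(2) l(2))
  then show "nf_width a \<le> width (rho p)" using k(3)[OF l(1)] by simp
  assume "width (rho p) = nf_width a"
  then have kl: "T.mx (rho (nf idx k)) = T.mx (rho (nf idx l))" using eq by simp
  \<comment> \<open>Every leading exponent lies between those of l and k, which now
    coincide.\<close>
  have "x = k" if "x \<in> N" for x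
  proof -
    have "T.mx (rho (nf idx x)) = T.mx (rho (nf idx k))"
      using k(3)[OF that] l(3)[OF that] width[OF that] width[OF l(1)] kl by simp
    then show ?thesis using inj_mx that k(1) by (auto dest: inj_onD)
  qed
  then have "N = {k}" using k(1) by blast
  then have "rho p = scl (f k) (rho (nf idx k))" using sum by simp
  moreover have "k = (fst k, a)" using k(1) by (simp add: N_def prod_eq_iff)
  ultimately show "\<exists>m c. c \<noteq> 0 \<and> rho p = scl c (rho (nf idx (m, a)))" using f[OF k(1)] by metis
qed

text \<open>A monomial has width 0, and each negative X-exponent would force positive width.\<close>

lemma monomial_in_image:
  assumes "rho p = sgl u c" "c \<noteq> 0"
  shows "0 \<le> xc u j"
proof -
  have "xdeg (rho p) (xc u)" using assms by (simp add: xdeg_def)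
  moreover have "rho p \<noteq> 0" using assms by (metis lookup_single_eq lookup_zero)
  ultimately have "nf_width (xc u) \<le> width (rho p)" by (intro homogeneous_width(1))
  then have "nf_width (xc u) \<le> 0"
    using assms by (simp add: width_def T.mx_single T.mn_single)
  moreover have "0 \<le> nf_width (xc u)" unfolding nf_width_def by (rule width_nonneg[OF rho_nf_nz])
  ultimately have "nf_width (xc u) = 0" by simp
  then show ?thesis using zc_nf_width[of "xc u" j] by simp
qed

section \<open>Endomorphisms\<close>

context
  fixes img :: "'n gen \<Rightarrow> ('n, 'k) fa"
  assumes endo: "AZ_endo q L img"
begin

text \<open>The endomorphism followed by the embedding. Its injectivity and surjectivity become: the
  kernel of \<open>\<theta>\<close> lies in J, and its range contains that of
  \<open>rho\<close>.\<close>

definition \<theta> :: "('n, 'k) fa \<Rightarrow> 'n lattice \<Rightarrow>\<^sub>0 'k" where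
  "\<theta> p = rho (fa_subst img p)"

lemma theta_hom: "T.algebra_hom \<theta>"
  using T.algebra_hom_comp_subst[OF rho_hom] by (simp add: \<theta>_def[abs_def])

lemma theta_J: "p \<in> J \<Longrightarrow> \<theta> p = 0"
  using endo by (simp add: AZ_endo_def \<theta>_def rho_J)

lemmas theta_simps = T.hom_add[OF theta_hom] T.hom_mult[OF theta_hom] T.hom_scl[OF theta_hom]
  T.hom_one[OF theta_hom]

text \<open>The images of z and its inverse w are monomials with opposite exponents. Both lie in the
  image of \<open>rho\<close>, so the X-exponents are nonnegative with either sign.\<close>

lemma theta_z_monomial:
  obtains u c d where "c \<noteq> 0" "d \<noteq> 0" "\<theta> (gz i) = sgl u c" "\<theta> (gw i) = sgl (- u) d"
    "\<And>j. xc u j = 0"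
proof -
  obtain u c d where u: "c \<noteq> 0" "d \<noteq> 0" "\<theta> (gz i) = sgl u c" "\<theta> (gw i) = sgl (- u) d"
    using T.unit_imp_monomial[OF hom_zw[OF theta_hom theta_J, of i]] by metis
  moreover have "xc u j = 0" for j
    using monomial_in_image[of _ u c j] monomial_in_image[of _ "- u" d j] u by (force simp: \<theta>_def)
  ultimately show thesis by (rule that)
qed

text \<open>Commutation with the images of the z_i pairs X-exponents with the Z-exponents of
  \<open>u i\<close>. Multiplicative independence turns the preserved relations into integer
  equations whose solutions are signs.\<close>

lemma theta_structure:
  obtains \<epsilon> c d where
    "\<And>i. \<epsilon> i = 1 \<or> \<epsilon> i = (- 1 :: int)" "\<And>i. c i \<noteq> 0" "\<And>i. d i \<noteq> 0"
    "\<And>i. \<theta> (gz i) = sgl (sgl (False, i) (\<epsilon> i)) (c i)"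
    "\<And>i. \<theta> (gw i) = sgl (sgl (False, i) (- \<epsilon> i)) (d i)"
    "\<And>i. xdeg (\<theta> (gx i)) (\<lambda>j. if j = i then \<epsilon> i else 0)"
    "\<And>i. xdeg (\<theta> (gy i)) (\<lambda>j. if j = i then - \<epsilon> i else 0)"
proof -
  have "\<forall>i. \<exists>u c d. c \<noteq> 0 \<and> d \<noteq> 0 \<and> \<theta> (gz i) = sgl u c \<and> \<theta> (gw i) = sgl (- u) d \<and> (\<forall>j. xc u j = 0)"
    using theta_z_monomial by metis
  then obtain u c d where u: "\<And>i. c i \<noteq> 0" "\<And>i. d i \<noteq> 0" "\<And>i. \<theta> (gz i) = sgl (u i) (c i)"
    "\<And>i. \<theta> (gw i) = sgl (- u i) (d i)" "\<And>i j. xc (u i) j = 0"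
    by metis
  \<comment> \<open>Moving the Z-monomial past an exponent v of the image of p produces a product of
    powers of all q_k, which must match the power of q_i in the given relation.\<close>
  have key: "xc v k * zc (u i) k = (if k = i then - e else 0)"
    if "qcomm (q i powi e) (gz i) p" "v \<in> ks (\<theta> p)" for i e p v k
  proof -
    have "sgl (u i) (c i) \<odot> \<theta> p = scl (q i powi e) (\<theta> p \<odot> sgl (u i) (c i))"
      using hom_qcomm[OF theta_hom theta_J that(1)] by (simp add: u(3))
    from T.monomial_twisted_commute_key[OF this u(1) that(2)]
    have "1 = q i powi e * (\<Prod>k\<in>UNIV. q k powi (xc v k * zc (u i) k))"
      by (simp add: chi_left_xc_zero[OF u(5)] chi_right_xc_zero[OF u(5)])
    also have "q i powi e = (\<Prod>k\<in>UNIV. if k = i then q i powi e else 1)" by simp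
    also have "\<dots> = (\<Prod>k\<in>UNIV. q k powi (if k = i then e else 0))"
      by (intro prod.cong refl) simp
    finally have "(\<Prod>k\<in>UNIV. q k powi ((if k = i then e else 0) + xc v k * zc (u i) k)) = 1"
      by (simp only: power_int_add q_nz prod.distrib simp_thms not_False_eq_True)
    from mult_indep[OF this] show ?thesis by (auto dest: spec[of _ k])
  qed
  have y: "xc v k * zc (u i) k = (if k = i \<and> i = j then - 1 else 0)" if "v \<in> ks (\<theta> (gy j))" for v i j k
  proof (cases "i = j")
    case True
    have "qcomm (q i powi 1) (gz i) (gy i)"
      using qcomm_sym[OF qcomm_yz_same[of i], of "q i"] q_nz[of i] by simp
    from key[OF this, of v k] True that show ?thesis by simp
  next
    case False
    then have "qcomm (q i powi 0) (gz i) (gy j)" using qcomm_sym[OF qcomm_yz[of j i]] by simp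
    from key[OF this, of v k] False that show ?thesis by simp
  qed
  have x: "xc v k * zc (u i) k = (if k = i \<and> i = j then 1 else 0)" if "v \<in> ks (\<theta> (gx j))" for v i j k
  proof (cases "i = j")
    case True
    have "qcomm (q i powi - 1) (gz i) (gx i)"
      using qcomm_sym[OF qcomm_xz_same[of i], of "inverse (q i)"] q_nz[of i]
      by (simp add: power_int_minus)
    from key[OF this, of v k] True that show ?thesis by simp
  next
    case False
    then have "qcomm (q i powi 0) (gz i) (gx j)" using qcomm_sym[OF qcomm_xz[of j i]] by simp
    from key[OF this, of v k] False that show ?thesis by simp
  qed
  define \<epsilon> where "\<epsilon> i = zc (u i) i" for i
  have \<epsilon>: "(\<epsilon> j = 1 \<or> \<epsilon> j = - 1) \<and> (\<forall>i. i \<noteq> j \<longrightarrow> zc (u i) j = 0)" for j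
  proof -
    obtain v where v: "v \<in> ks (\<theta> (gx j))" using T.mx_in_keys hom_x_nz[OF theta_hom theta_J] by blast
    \<comment> \<open>Two integers with product 1 are \<plusminus>1. As the X-exponent is then
      nonzero, the equations for i \<noteq> j remove the off-diagonal Z-exponents.\<close>
    have "xc v j * \<epsilon> j = 1" using x[OF v, of j j] by (simp add: \<epsilon>_def)
    then have "\<epsilon> j = 1 \<or> \<epsilon> j = - 1" "xc v j \<noteq> 0" by (auto simp: zmult_eq_1_iff)
    moreover have "zc (u i) j = 0" if "i \<noteq> j" for i using x[OF v, of j i] that \<open>xc v j \<noteq> 0\<close> by simp
    ultimately show ?thesis by blast
  qed
  have u_eq: "u i = sgl (False, i) (\<epsilon> i)" for i
    by (rule lattice_eqI) (use \<epsilon> u(5) in \<open>auto simp: \<epsilon>_def lookup_single when_def\<close>)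
  show thesis
  proof (rule that[of \<epsilon> c d])
    fix i
    show "xdeg (\<theta> (gx i)) (\<lambda>j. if j = i then \<epsilon> i else 0)"
      unfolding xdeg_def
    proof (intro ballI allI)
      fix v j assume "v \<in> ks (\<theta> (gx i))"
      from x[OF this, of j j] \<epsilon>[of j] show "xc v j = (if j = i then \<epsilon> i else 0)"
        by (auto simp: \<epsilon>_def)
    qed
    show "xdeg (\<theta> (gy i)) (\<lambda>j. if j = i then - \<epsilon> i else 0)"
      unfolding xdeg_def
    proof (intro ballI allI)
      fix v j assume "v \<in> ks (\<theta> (gy i))"
      from y[OF this, of j j] \<epsilon>[of j] show "xc v j = (if j = i then - \<epsilon> i else 0)"
        by (auto simp: \<epsilon>_def)
    qed
  qed (use \<epsilon> u u_eq in \<open>auto simp flip: single_uminus\<close>)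
qed

section \<open>Injectivity\<close>

lemma theta_kernel:
  assumes "\<theta> p = 0"
  shows "p \<in> J"
proof (rule theta_structure)
  fix \<epsilon> c d
  assume \<epsilon>: "\<And>i. \<epsilon> i = 1 \<or> \<epsilon> i = (- 1 :: int)" and c: "\<And>i. c i \<noteq> 0"
    and z: "\<And>i. \<theta> (gz i) = sgl (sgl (False, i) (\<epsilon> i)) (c i)"
    and x: "\<And>i. xdeg (\<theta> (gx i)) (\<lambda>j. if j = i then \<epsilon> i else 0)"
    and y: "\<And>i. xdeg (\<theta> (gy i)) (\<lambda>j. if j = i then - \<epsilon> i else 0)"
  have "inj (\<lambda>k. T.mx (\<theta> (nf idx k)))"
  proof (rule mx_nf_inj[OF theta_hom theta_J])
    show "\<epsilon> i \<noteq> 0" for i using \<epsilon>[of i] by auto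
    show "T.mx (\<theta> (gz i)) = sgl (False, i) (\<epsilon> i)" for i by (simp add: z T.mx_single c)
    show "xc (T.mx (\<theta> (gx i))) j = (if j = i then \<epsilon> i else 0)" for i j
      using x[of i] T.mx_in_keys[OF hom_x_nz[OF theta_hom theta_J]] by (simp add: xdeg_def)
    show "xc (T.mx (\<theta> (gy i))) j = (if j = i then - \<epsilon> i else 0)" for i j
      using y[of i] T.mx_in_keys[OF hom_y_nz[OF theta_hom theta_J]] by (simp add: xdeg_def)
  qed
  then show ?thesis using hom_kernel[OF theta_hom theta_J] assms by blast
qed

section \<open>Surjectivity\<close>

lemma range_theta_mult: "s \<in> range \<theta> \<Longrightarrow> t \<in> range \<theta> \<Longrightarrow> s \<odot> t \<in> range \<theta>"
  by (auto simp flip: theta_simps)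

lemma range_theta_scl: "t \<in> range \<theta> \<Longrightarrow> scl c t \<in> range \<theta>"
  by (auto simp flip: theta_simps)

lemma range_theta_one: "1 \<in> range \<theta>"
  using theta_simps(4) by (metis rangeI)

lemma range_theta_scl_iff: "scl c t \<in> range \<theta> \<Longrightarrow> c \<noteq> 0 \<Longrightarrow> t \<in> range \<theta>"
  using range_theta_scl[of "scl c t" "1 / c"] by simp

text \<open>Once all powers of z lie in the range, a Z-monomial from the range can strip them from a
  normal form whose z-exponents are unknown.\<close>

lemma peel_zpow:
  assumes zpow: "\<And>i m. rho (zpow i m) \<in> range \<theta>"
  shows "\<exists>u c. c \<noteq> 0 \<and> (\<forall>j. xc u j = 0) \<and> sgl u 1 \<in> range \<theta> \<and>
    sgl u 1 \<odot> rho (nf is (m, a)) = scl c (rho (nf is ((\<lambda>_. 0), a)))"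
proof (induction "is")
  case Nil
  show ?case using range_theta_one
    by (intro exI[of _ 0] exI[of _ 1]) (simp add: nf_Nil rho_simps)
next
  case (Cons i "is")
  then obtain u c where u: "c \<noteq> 0" "\<And>j. xc u j = 0" "sgl u 1 \<in> range \<theta>"
    "sgl u 1 \<odot> rho (nf is (m, a)) = scl c (rho (nf is ((\<lambda>_. 0), a)))"
    by blast
  let ?w = "sgl (False, i) (- m i) :: 'n lattice" and ?v = "rho (vpow i (a i))"
  have w: "sgl ?w 1 \<odot> rho (zpow i (m i)) = 1"
  proof -
    have "chi ?w v = 1" for v by (rule chi_left_xc_zero) (simp add: lookup_single)
    then show ?thesis by (simp add: rho_zpow T.tmult_single flip: single_add)
  qed
  have uw: "sgl u 1 \<odot> sgl ?w 1 = sgl (u + ?w) 1"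
    by (simp add: T.tmult_single chi_left_xc_zero[OF u(2)])
  \<comment> \<open>The common value of \<open>chi v u\<close> on the exponents v of ?v, which all
    have X-degree a i at i and 0 elsewhere.\<close>
  define e where "e = (\<Prod>k\<in>UNIV. q k powi ((if k = i then a i else 0) * zc u k))"
  have e: "e \<noteq> 0" by (simp add: e_def q_nz)
  have comm: "sgl u 1 \<odot> ?v = scl (1 / e) (?v \<odot> sgl u 1)"
  proof (rule T.tmult_twisted_commute)
    fix u' v assume "u' \<in> ks (sgl u (1::'k))" and v: "v \<in> ks ?v"
    then have "u' = u" by simp
    have "chi v u = e"
      using xdeg_rho_vpow[of i "a i"] v by (simp add: chi_right_xc_zero[OF u(2)] e_def xdeg_def)
    then show "chi u' v = 1 / e * chi v u'"
      using e by (simp add: \<open>u' = u\<close> chi_left_xc_zero[OF u(2)])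
  qed
  have "sgl (u + ?w) 1 \<odot> rho (nf (i # is) (m, a))
      = sgl u 1 \<odot> ((sgl ?w 1 \<odot> rho (zpow i (m i))) \<odot> (?v \<odot> rho (nf is (m, a))))"
    by (simp add: nf_Cons block_def rho_simps T.tmult_assoc flip: uw)
  also have "\<dots> = (sgl u 1 \<odot> ?v) \<odot> rho (nf is (m, a))" by (simp add: w T.tmult_assoc)
  also have "\<dots> = scl (c / e) (rho (nf (i # is) ((\<lambda>_. 0), a)))"
    by (simp add: comm T.tmult_assoc u(4) nf_Cons block_def rho_simps)
  finally have "sgl (u + ?w) 1 \<odot> rho (nf (i # is) (m, a))
      = scl (c / e) (rho (nf (i # is) ((\<lambda>_. 0), a)))" .
  moreover have "sgl (u + ?w) 1 \<in> range \<theta>"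
    unfolding uw[symmetric] using zpow[of i "- m i"] u(3) by (intro range_theta_mult) (simp_all add: rho_zpow)
  moreover have "xc (u + ?w) j = 0" for j by (simp add: lookup_add lookup_single u(2))
  ultimately show ?case using u(1) e by (intro exI[of _ "u + ?w"] exI[of _ "c / e"]) simp
qed

text \<open>Minimal width makes the image of p a multiple of one normal form; after
  \<open>peel_zpow\<close> only the power of v at index i is left.\<close>

lemma vpow_in_range:
  assumes zpow: "\<And>i m. rho (zpow i m) \<in> range \<theta>"
    and "\<theta> p \<noteq> 0" "xdeg (\<theta> p) a" "width (\<theta> p) = nf_width a" and a: "a = (\<lambda>j. if j = i then e else 0)"
  shows "rho (vpow i e) \<in> range \<theta>"
proof -
  obtain m c where m: "c \<noteq> 0" "\<theta> p = scl c (rho (nf idx (m, a)))"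
    using homogeneous_width(2) assms(2-4) unfolding \<theta>_def by blast
  then have "rho (nf idx (m, a)) \<in> range \<theta>" using range_theta_scl_iff by (metis rangeI)
  moreover obtain u d where "d \<noteq> 0" "sgl u 1 \<in> range \<theta>"
    "sgl u 1 \<odot> rho (nf idx (m, a)) = scl d (rho (nf idx ((\<lambda>_. 0), a)))"
    using peel_zpow[OF zpow] by blast
  ultimately have "rho (nf idx ((\<lambda>_. 0), a)) \<in> range \<theta>"
    using range_theta_mult range_theta_scl_iff by metis
  then show ?thesis by (simp add: a nf_zero)
qed

text \<open>It suffices to reach the generators. The monomials z and w come from
  \<open>theta_structure\<close>, while x and y come from comparing widths in the product
  yx.\<close>

lemma rho_in_range_theta: "rho p \<in> range \<theta>"
proof (rule theta_structure)
  fix \<epsilon> c d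
  assume \<epsilon>: "\<And>i. \<epsilon> i = 1 \<or> \<epsilon> i = (- 1 :: int)" and c: "\<And>i. c i \<noteq> 0" and d: "\<And>i. d i \<noteq> 0"
    and z: "\<And>i. \<theta> (gz i) = sgl (sgl (False, i) (\<epsilon> i)) (c i)"
    and w: "\<And>i. \<theta> (gw i) = sgl (sgl (False, i) (- \<epsilon> i)) (d i)"
    and x: "\<And>i. xdeg (\<theta> (gx i)) (\<lambda>j. if j = i then \<epsilon> i else 0)"
    and y: "\<And>i. xdeg (\<theta> (gy i)) (\<lambda>j. if j = i then - \<epsilon> i else 0)"
  have mono: "sgl (sgl (False, i) (\<epsilon> i)) 1 \<in> range \<theta>" "sgl (sgl (False, i) (- \<epsilon> i)) 1 \<in> range \<theta>" for i
    using range_theta_scl[OF rangeI, of "1 / c i" "gz i"] range_theta_scl[OF rangeI, of "1 / d i" "gw i"]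
      c[of i] d[of i]
    by (simp_all add: z w)
  have zw: "rho (gz i) \<in> range \<theta>" "rho (gw i) \<in> range \<theta>" for i
    using \<epsilon>[of i] mono[of i] by (auto simp: rho_z rho_w single_uminus)
  have power: "rho (p ^ k) \<in> range \<theta>" if "rho p \<in> range \<theta>" for p k
    using that by (induction k) (simp_all add: rho_simps range_theta_one range_theta_mult)
  have zpow: "rho (zpow i m) \<in> range \<theta>" for i m
    using power[OF zw(1)] power[OF zw(2)] by (simp add: zpow_def)
  have xy: "rho (gx i) \<in> range \<theta> \<and> rho (gy i) \<in> range \<theta>" for i
  proof -
    let ?a = "\<lambda>j. if j = i then \<epsilon> i else 0" and ?b = "\<lambda>j. if j = i then - \<epsilon> i else 0"
    let ?u = "sgl (False, i) (\<epsilon> i) :: 'n lattice" and ?\<kappa> = "1 / (q i - 1)"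
    note nz = hom_y_nz[OF theta_hom theta_J, of i] hom_x_nz[OF theta_hom theta_J, of i]
    have "?u \<noteq> 0" using \<epsilon>[of i] by (auto dest: arg_cong[where f = "\<lambda>u. zc u i"])
    have "\<theta> (gy i) \<odot> \<theta> (gx i) = sgl ?u (?\<kappa> * c i) - sgl 0 ?\<kappa>"
      using hom_yx[OF theta_hom theta_J, of i] by (simp add: z flip: single_one)
    moreover have "ks (sgl ?u (?\<kappa> * c i) - sgl 0 ?\<kappa>) = {?u, 0}"
      using \<open>?u \<noteq> 0\<close> c[of i] q_neq_1[of i]
      by (auto simp: in_keys_iff lookup_minus lookup_single when_def split: if_splits)
    \<comment> \<open>Which of the two exponents is the larger depends on the sign of \<epsilon>
      i.\<close>
    ultimately have "width (\<theta> (gy i) \<odot> \<theta> (gx i)) = max ?u 0 - min ?u 0"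
      by (simp add: width_def T.mx_def T.mn_def)
    also have "\<dots> = eZ i"
      using \<epsilon>[of i] single_pos[of 1 "(False, i)"] by (auto simp: single_uminus)
    \<comment> \<open>For either sign, one of the degrees \<epsilon> i and - \<epsilon> i is -1 and
      contributes \<open>eZ i\<close>; the other contributes 0.\<close>
    also have "\<dots> = nf_width ?b + nf_width ?a"
      using \<epsilon>[of i]
      by (intro lattice_eqI) (auto simp: lookup_add zc_nf_width xc_nf_width lookup_single when_def)
    finally have eq: "nf_width ?b + nf_width ?a = width (\<theta> (gy i)) + width (\<theta> (gx i))"
      by (simp add: width_tmult nz)
    have "nf_width ?b \<le> width (\<theta> (gy i))" "nf_width ?a \<le> width (\<theta> (gx i))"
      using homogeneous_width(1) x[of i] y[of i] nz by (simp_all add: \<theta>_def)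
    \<comment> \<open>Each factor is at least as wide as its degree demands and the total is exact,
      so both bounds are attained.\<close>
    note w = add_mono_eq_imp[OF this eq]
    have "rho (vpow i (\<epsilon> i)) \<in> range \<theta>" "rho (vpow i (- \<epsilon> i)) \<in> range \<theta>"
      using vpow_in_range[OF zpow nz(2) x w(2)[symmetric]] vpow_in_range[OF zpow nz(1) y w(1)[symmetric]]
      by auto
    \<comment> \<open>For \<epsilon> i = 1 the two powers are x and y, for \<epsilon> i = -1 they
      are y and x.\<close>
    then show ?thesis using \<epsilon>[of i] by (auto simp: vpow_def)
  qed
  show ?thesis
  proof (induction p rule: fa_generator_induct)
    case (generator g p)
    have "rho (fa_gen g) \<in> range \<theta>"
      using xy zw by (cases g) (auto simp: gx_def gy_def gw_def)
    then show ?case using generator by (simp add: rho_simps range_theta_mult)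
  next
    case (add p r)
    then show ?case by (auto simp: rho_simps simp flip: theta_simps)
  qed (simp_all add: rho_simps range_theta_one range_theta_scl)
qed

lemma endo_imp_auto: "AZ_auto q L img"
  unfolding AZ_auto_def
proof (intro conjI allI impI)
  show "AZ_endo q L img" by (rule endo)
  show "p \<in> J" if "fa_subst img p \<in> J" for p
    using theta_kernel[of p] rho_J[OF that] by (simp add: \<theta>_def)
  show "\<exists>g. fa_subst img g - f \<in> J" for f
  proof -
    obtain g where "\<theta> g = rho f" using rho_in_range_theta[of f] by (metis imageE)
    then have "rho (fa_subst img g - f) = 0" by (simp add: \<theta>_def rho_simps)
    then show ?thesis using rho_kernel by blast
  qed
qed

end

end

theorem theorem3p1:
  fixes q :: "'n::{finite,linorder} \<Rightarrow> 'k::field"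
    and L :: "'n \<Rightarrow> 'n \<Rightarrow> 'k"
    and img :: "'n gen \<Rightarrow> ('n, 'k) fa"
  assumes q_nz: "\<And>i. q i \<noteq> 0"
    and L_nz: "\<And>i j. L i j \<noteq> 0"
    and L_inv: "\<And>i j. L i j = inverse (L j i)"
    and L_diag: "\<And>i. L i i = 1"
    and mult_indep: "\<And>e :: 'n \<Rightarrow> int. (\<Prod>i\<in>UNIV. q i powi e i) = 1 \<Longrightarrow> (\<forall>i. e i = 0)"
    and endo: "AZ_endo q L img"
  shows "AZ_auto q L img"
proof -
  interpret quantum_weyl q L
    using q_nz L_nz L_inv mult_indep by unfold_locales
  show ?thesis using endo by (rule endo_imp_auto)
qed

end
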